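(* Let $A$ and $A'$ be two quasicrossed products of $G$ over the same associative algebra $A_e$ (that is, $A'_e=A_e$). Then $A$ and $A'$ are equivalent if and only if they determine the same equivalence class of quasicrossed systems for $G$ over $A_e$.
   Context: $\mathbb{K}$ is an algebraically closed field of characteristic zero and $G$ is a group with neutral element $e$. Algebras are nonzero $\mathbb{K}$-algebras with identity $1$, not necessarily associative unless stated. A $G$-graded algebra is an algebra $A=\bigoplus_{g\in G}A_g$ with $A_gA_h\subset A_{gh}$ for all $g,h\in G$; the set of $g$ with $A_g\neq 0$ generates $G$. A cocycle is a map $\phi:G\times G\times G\to\mathbb{K}^\times$ with $\phi(h,k,l)\phi(g,hk,l)\phi(g,h,k)=\phi(g,h,kl)\phi(gh,k,l)$ and $\phi(g,e,h)=1$ for all $g,h,k,l\in G$. A $G$-graded quasialgebra with cocycle $\phi$ is a $G$-graded algebra satisfying $(x_gx_h)x_k=\phi(g,h,k)\,x_g(x_hx_k)$ for all $x_g\in A_g$, $x_h\in A_h$, $x_k\in A_k$. Then $1\in A_e$ and $A_e$ is an associative algebra. A unit of $A$ is an element $u$ having a left inverse $u_L^{-1}$ ($u_L^{-1}u=1$) and a right inverse $u_R^{-1}$ ($uu_R^{-1}=1$); $U(A)$ is the set of units. For units in $A_g$ these inverses are unique and lie in $A_{g^{-1}}$. $A$ is a quasicrossed product of $G$ over $A_e$ if $U(A)\cap A_g\neq\emptyset$ for every $g\in G$. Quasicrossed systems: for an associative algebra $B$, a quasicrossed system for $G$ over $B$ is $(G,B,\phi,\sigma,\alpha)$ with $\phi$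 a cocycle and maps $\sigma:G\to\mathrm{Aut}(B)$, $\alpha:G\times G\to U(B)$ such that for all $g,h,k\in G$, $x\in B$: $\sigma(g)(\sigma(h)(x))=\alpha(g,h)\sigma(gh)(x)\alpha(g,h)^{-1}$; $\alpha(g,h)\alpha(gh,k)=\phi(g,h,k)\sigma(g)(\alpha(h,k))\alpha(g,hk)$; $\alpha(g,e)=\alpha(e,g)=1$. Equivalence of quasicrossed systems: two quasicrossed systems $(G,B,\phi,\sigma,\alpha)$ and $(G,B,\phi,\sigma',\alpha')$ (same $G$, $B$ and $\phi$) are equivalent if there is a map $u:G\to U(B)$ with $u(e)=1$ such that for all $g,h\in G$: $\sigma'(g)=i_{u(g)}\circ\sigma(g)$ and $\alpha'(g,h)=u(g)\,\sigma(g)(u(h))\,\alpha(g,h)\,u(gh)^{-1}$, where $i_y(x)=yxy^{-1}$. This is an equivalence relation. Class determined by a quasicrossed product: if $A$ (with cocycle $\phi$) is a quasicrossed product of $G$ over $A_e$, choose units $\overline{g}\in U(A)\cap A_g$ for all $g$, with $\overline{e}=1$; the corresponding quasicrossed system is $(G,A_e,\phi,\sigma,\alpha)$ with $\sigma(g)(x)=\overline{g}x\overline{g}_R^{-1}$ and $\alpha(g,h)=(\overline{g}\,\overline{h})(\overline{gh})_R^{-1}$. Its equivalence class does not depend on the choice of units and is the class determined by $A$. Equivalence of quasicrossed products: $A$ and $A'$ are equivalent if there is an isomorphism of algebras $f:A\to A'$ with $f(A_g)=A'_g$ for all $g\in G$ and $f(x)=x$ for all $x\in A_e$. *)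

theory Defs
  imports "HOL-Algebra.Algebra"
begin

section \<open>Algebras\<close>

definition char_zero :: "('k, 'm) ring_scheme \<Rightarrow> bool" where
  "char_zero K \<longleftrightarrow> (\<forall>n::nat. n > 0 \<longrightarrow> [n] \<cdot>\<^bsub>K\<^esub> \<one>\<^bsub>K\<^esub> \<noteq> \<zero>\<^bsub>K\<^esub>)"

text \<open>
  Nonzero algebras with identity, not necessarily associative or commutative
  (the library locale \<^locale>\<open>algebra\<close> requires both).
\<close>

locale unital_algebra = K?: field K + module K A for K (structure) and A (structure) +
  assumes mult_closed:
      "\<lbrakk> x \<in> carrier A; y \<in> carrier A \<rbrakk> \<Longrightarrow> x \<otimes>\<^bsub>A\<^esub> y \<in> carrier A"
    and mult_l_distr:
      "\<lbrakk> x \<in> carrier A; y \<in> carrier A; z \<in> carrier A \<rbrakk> \<Longrightarrow>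
        (x \<oplus>\<^bsub>A\<^esub> y) \<otimes>\<^bsub>A\<^esub> z = (x \<otimes>\<^bsub>A\<^esub> z) \<oplus>\<^bsub>A\<^esub> (y \<otimes>\<^bsub>A\<^esub> z)"
    and mult_r_distr:
      "\<lbrakk> x \<in> carrier A; y \<in> carrier A; z \<in> carrier A \<rbrakk> \<Longrightarrow>
        z \<otimes>\<^bsub>A\<^esub> (x \<oplus>\<^bsub>A\<^esub> y) = (z \<otimes>\<^bsub>A\<^esub> x) \<oplus>\<^bsub>A\<^esub> (z \<otimes>\<^bsub>A\<^esub> y)"
    and smult_mult_l:
      "\<lbrakk> a \<in> carrier K; x \<in> carrier A; y \<in> carrier A \<rbrakk> \<Longrightarrow>
        (a \<odot>\<^bsub>A\<^esub> x) \<otimes>\<^bsub>A\<^esub> y = a \<odot>\<^bsub>A\<^esub> (x \<otimes>\<^bsub>A\<^esub> y)"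
    and smult_mult_r:
      "\<lbrakk> a \<in> carrier K; x \<in> carrier A; y \<in> carrier A \<rbrakk> \<Longrightarrow>
        x \<otimes>\<^bsub>A\<^esub> (a \<odot>\<^bsub>A\<^esub> y) = a \<odot>\<^bsub>A\<^esub> (x \<otimes>\<^bsub>A\<^esub> y)"
    and unit_closed: "\<one>\<^bsub>A\<^esub> \<in> carrier A"
    and unit_l: "x \<in> carrier A \<Longrightarrow> \<one>\<^bsub>A\<^esub> \<otimes>\<^bsub>A\<^esub> x = x"
    and unit_r: "x \<in> carrier A \<Longrightarrow> x \<otimes>\<^bsub>A\<^esub> \<one>\<^bsub>A\<^esub> = x"
    and nonzero: "carrier A \<noteq> {\<zero>\<^bsub>A\<^esub>}"

locale assoc_unital_algebra = unital_algebra K A for K (structure) and A (structure) +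
  assumes mult_assoc:
      "\<lbrakk> x \<in> carrier A; y \<in> carrier A; z \<in> carrier A \<rbrakk> \<Longrightarrow>
        (x \<otimes>\<^bsub>A\<^esub> y) \<otimes>\<^bsub>A\<^esub> z = x \<otimes>\<^bsub>A\<^esub> (y \<otimes>\<^bsub>A\<^esub> z)"

definition algebra_iso ::
  "('k, 'm) ring_scheme \<Rightarrow> ('k, 'a, 'p) module_scheme \<Rightarrow> ('k, 'b, 'q) module_scheme \<Rightarrow> ('a \<Rightarrow> 'b) set"
  where
  "algebra_iso K A B =
    {f \<in> ring_iso A B. \<forall>a\<in>carrier K. \<forall>x\<in>carrier A. f (a \<odot>\<^bsub>A\<^esub> x) = a \<odot>\<^bsub>B\<^esub> f x}"

abbreviation algebra_aut ::
  "('k, 'm) ring_scheme \<Rightarrow> ('k, 'a, 'p) module_scheme \<Rightarrow> ('a \<Rightarrow> 'a) set" where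
  "algebra_aut K A \<equiv> algebra_iso K A A"

text \<open>
  Record equality would also compare the operations outside the carrier, hence this
  relation for ``the same algebra''.
\<close>

definition same_algebra ::
  "('k, 'm) ring_scheme \<Rightarrow> ('k, 'a, 'p) module_scheme \<Rightarrow> ('k, 'a, 'q) module_scheme \<Rightarrow> bool" where
  "same_algebra K A B \<longleftrightarrow>
    carrier A = carrier B \<and> \<zero>\<^bsub>A\<^esub> = \<zero>\<^bsub>B\<^esub> \<and> \<one>\<^bsub>A\<^esub> = \<one>\<^bsub>B\<^esub> \<and>
    (\<forall>x\<in>carrier A. \<forall>y\<in>carrier A. x \<oplus>\<^bsub>A\<^esub> y = x \<oplus>\<^bsub>B\<^esub> y \<and> x \<otimes>\<^bsub>A\<^esub> y = x \<otimes>\<^bsub>B\<^esub> y) \<and>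
    (\<forall>a\<in>carrier K. \<forall>x\<in>carrier A. a \<odot>\<^bsub>A\<^esub> x = a \<odot>\<^bsub>B\<^esub> x)"

text \<open>
  The left and the right inverse of a unit may differ when the product is not associative.
\<close>

definition lr_units :: "('a, 'm) monoid_scheme \<Rightarrow> 'a set" where
  "lr_units A =
    {u \<in> carrier A. (\<exists>v\<in>carrier A. v \<otimes>\<^bsub>A\<^esub> u = \<one>\<^bsub>A\<^esub>) \<and> (\<exists>w\<in>carrier A. u \<otimes>\<^bsub>A\<^esub> w = \<one>\<^bsub>A\<^esub>)}"

definition right_inv :: "('a, 'm) monoid_scheme \<Rightarrow> 'a \<Rightarrow> 'a" where
  "right_inv A u = (THE w. w \<in> carrier A \<and> u \<otimes>\<^bsub>A\<^esub> w = \<one>\<^bsub>A\<^esub>)"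

lemma (in assoc_unital_algebra) lr_units_eq_Units: "lr_units A = Units A"
proof
  show "lr_units A \<subseteq> Units A"
  proof
    fix u assume "u \<in> lr_units A"
    then obtain v w where uvw: "u \<in> carrier A" "v \<in> carrier A" "w \<in> carrier A"
      and vu: "v \<otimes>\<^bsub>A\<^esub> u = \<one>\<^bsub>A\<^esub>" and uw: "u \<otimes>\<^bsub>A\<^esub> w = \<one>\<^bsub>A\<^esub>"
      unfolding lr_units_def by blast
    have "v = v \<otimes>\<^bsub>A\<^esub> (u \<otimes>\<^bsub>A\<^esub> w)" using uw uvw unit_r by simp
    also have "\<dots> = w" using vu uvw unit_l mult_assoc[of v u w] by simp
    finally show "u \<in> Units A" using uvw vu uw unfolding Units_def by blast
  qed
  show "Units A \<subseteq> lr_units A" unfolding Units_def lr_units_def by blast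
qed

section \<open>Graded quasialgebras and quasicrossed products\<close>

text \<open>
  The direct sum decomposition says that every element is, in exactly one way, a sum of a
  finitely supported family of homogeneous elements.
\<close>

locale graded_algebra = G?: group G + unital_algebra K A
  for K (structure) and G (structure) and A (structure) and gr +
  assumes gr_submodule: "g \<in> carrier G \<Longrightarrow> submodule (gr g) K A"
    and gr_direct_sum:
      "x \<in> carrier A \<Longrightarrow>
        \<exists>!f. f \<in> (\<Pi>\<^sub>E g\<in>carrier G. gr g) \<and> finite {g \<in> carrier G. f g \<noteq> \<zero>\<^bsub>A\<^esub>} \<and>
             x = finsum A f {g \<in> carrier G. f g \<noteq> \<zero>\<^bsub>A\<^esub>}"
    and gr_mult:
      "\<lbrakk> g \<in> carrier G; h \<in> carrier G; x \<in> gr g; y \<in> gr h \<rbrakk> \<Longrightarrow> x \<otimes>\<^bsub>A\<^esub> y \<in> gr (g \<otimes>\<^bsub>G\<^esub> h)"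
    and gr_support: "generate G {g \<in> carrier G. gr g \<noteq> {\<zero>\<^bsub>A\<^esub>}} = carrier G"

definition cocycle ::
  "('k, 'm) ring_scheme \<Rightarrow> ('g, 'n) monoid_scheme \<Rightarrow> ('g \<Rightarrow> 'g \<Rightarrow> 'g \<Rightarrow> 'k) \<Rightarrow> bool" where
  "cocycle K G \<phi> \<longleftrightarrow>
    (\<forall>g\<in>carrier G. \<forall>h\<in>carrier G. \<forall>k\<in>carrier G. \<phi> g h k \<in> Units K) \<and>
    (\<forall>g\<in>carrier G. \<forall>h\<in>carrier G. \<forall>k\<in>carrier G. \<forall>l\<in>carrier G.
      \<phi> h k l \<otimes>\<^bsub>K\<^esub> \<phi> g (h \<otimes>\<^bsub>G\<^esub> k) l \<otimes>\<^bsub>K\<^esub> \<phi> g h k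
        = \<phi> g h (k \<otimes>\<^bsub>G\<^esub> l) \<otimes>\<^bsub>K\<^esub> \<phi> (g \<otimes>\<^bsub>G\<^esub> h) k l) \<and>
    (\<forall>g\<in>carrier G. \<forall>h\<in>carrier G. \<phi> g \<one>\<^bsub>G\<^esub> h = \<one>\<^bsub>K\<^esub>)"

locale graded_quasialgebra = graded_algebra K G A gr
  for K (structure) and G (structure) and A (structure) and gr and \<phi> +
  assumes cocycle: "cocycle K G \<phi>"
    and quasi_assoc:
      "\<lbrakk> g \<in> carrier G; h \<in> carrier G; k \<in> carrier G; x \<in> gr g; y \<in> gr h; z \<in> gr k \<rbrakk> \<Longrightarrow>
        (x \<otimes>\<^bsub>A\<^esub> y) \<otimes>\<^bsub>A\<^esub> z = \<phi> g h k \<odot>\<^bsub>A\<^esub> (x \<otimes>\<^bsub>A\<^esub> (y \<otimes>\<^bsub>A\<^esub> z))"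

locale quasicrossed_product = graded_quasialgebra K G A gr \<phi>
  for K (structure) and G (structure) and A (structure) and gr and \<phi> +
  assumes homogeneous_unit: "g \<in> carrier G \<Longrightarrow> lr_units A \<inter> gr g \<noteq> {}"

definition neutral_algebra ::
  "('g, 'n) monoid_scheme \<Rightarrow> ('k, 'a, 'p) module_scheme \<Rightarrow> ('g \<Rightarrow> 'a set) \<Rightarrow> ('k, 'a, 'p) module_scheme"
  where "neutral_algebra G A gr = A\<lparr>carrier := gr \<one>\<^bsub>G\<^esub>\<rparr>"

definition equivalent_products ::
  "('k, 'm) ring_scheme \<Rightarrow> ('g, 'n) monoid_scheme \<Rightarrow>
   ('k, 'a, 'p) module_scheme \<Rightarrow> ('g \<Rightarrow> 'a set) \<Rightarrow>
   ('k, 'a, 'q) module_scheme \<Rightarrow> ('g \<Rightarrow> 'a set) \<Rightarrow> bool" where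
  "equivalent_products K G A gr A' gr' \<longleftrightarrow>
    (\<exists>f \<in> algebra_iso K A A'.
      (\<forall>g\<in>carrier G. f ` gr g = gr' g) \<and> (\<forall>x\<in>gr \<one>\<^bsub>G\<^esub>. f x = x))"

section \<open>Quasicrossed systems\<close>

text \<open>The data \<open>\<phi>\<close>, \<open>\<sigma>\<close>, \<open>\<alpha>\<close> of a quasicrossed system for given \<open>G\<close> and \<open>B\<close>.\<close>

record ('k, 'g, 'a) qsystem =
  qcoc :: "'g \<Rightarrow> 'g \<Rightarrow> 'g \<Rightarrow> 'k"
  qact :: "'g \<Rightarrow> 'a \<Rightarrow> 'a"
  qtwist :: "'g \<Rightarrow> 'g \<Rightarrow> 'a"

definition quasicrossed_systems ::
  "('k, 'm) ring_scheme \<Rightarrow> ('g, 'n) monoid_scheme \<Rightarrow> ('k, 'a, 'p) module_scheme \<Rightarrow>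
   ('k, 'g, 'a) qsystem set" where
  "quasicrossed_systems K G B =
    {S. group G \<and> assoc_unital_algebra K B \<and> cocycle K G (qcoc S) \<and>
      (\<forall>g\<in>carrier G. qact S g \<in> algebra_aut K B) \<and>
      (\<forall>g\<in>carrier G. \<forall>h\<in>carrier G. qtwist S g h \<in> lr_units B) \<and>
      (\<forall>g\<in>carrier G. \<forall>h\<in>carrier G. \<forall>x\<in>carrier B.
        qact S g (qact S h x)
          = qtwist S g h \<otimes>\<^bsub>B\<^esub> qact S (g \<otimes>\<^bsub>G\<^esub> h) x \<otimes>\<^bsub>B\<^esub> inv\<^bsub>B\<^esub> (qtwist S g h)) \<and>
      (\<forall>g\<in>carrier G. \<forall>h\<in>carrier G. \<forall>k\<in>carrier G.
        qtwist S g h \<otimes>\<^bsub>B\<^esub> qtwist S (g \<otimes>\<^bsub>G\<^esub> h) k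
          = qcoc S g h k \<odot>\<^bsub>B\<^esub> (qact S g (qtwist S h k) \<otimes>\<^bsub>B\<^esub> qtwist S g (h \<otimes>\<^bsub>G\<^esub> k))) \<and>
      (\<forall>g\<in>carrier G. qtwist S g \<one>\<^bsub>G\<^esub> = \<one>\<^bsub>B\<^esub> \<and> qtwist S \<one>\<^bsub>G\<^esub> g = \<one>\<^bsub>B\<^esub>)}"

definition system_equiv ::
  "('k, 'm) ring_scheme \<Rightarrow> ('g, 'n) monoid_scheme \<Rightarrow> ('k, 'a, 'p) module_scheme \<Rightarrow>
   (('k, 'g, 'a) qsystem \<times> ('k, 'g, 'a) qsystem) set" where
  "system_equiv K G B =
    {(S, S'). S \<in> quasicrossed_systems K G B \<and> S' \<in> quasicrossed_systems K G B \<and>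
      (\<forall>g\<in>carrier G. \<forall>h\<in>carrier G. \<forall>k\<in>carrier G. qcoc S' g h k = qcoc S g h k) \<and>
      (\<exists>u \<in> carrier G \<rightarrow> lr_units B.
        u \<one>\<^bsub>G\<^esub> = \<one>\<^bsub>B\<^esub> \<and>
        (\<forall>g\<in>carrier G. \<forall>x\<in>carrier B.
          qact S' g x = u g \<otimes>\<^bsub>B\<^esub> qact S g x \<otimes>\<^bsub>B\<^esub> inv\<^bsub>B\<^esub> (u g)) \<and>
        (\<forall>g\<in>carrier G. \<forall>h\<in>carrier G.
          qtwist S' g h
            = u g \<otimes>\<^bsub>B\<^esub> qact S g (u h) \<otimes>\<^bsub>B\<^esub> qtwist S g h \<otimes>\<^bsub>B\<^esub> inv\<^bsub>B\<^esub> (u (g \<otimes>\<^bsub>G\<^esub> h))))}"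

definition unit_choices ::
  "('g, 'n) monoid_scheme \<Rightarrow> ('k, 'a, 'p) module_scheme \<Rightarrow> ('g \<Rightarrow> 'a set) \<Rightarrow> ('g \<Rightarrow> 'a) set" where
  "unit_choices G A gr =
    {c. (\<forall>g\<in>carrier G. c g \<in> lr_units A \<inter> gr g) \<and> c \<one>\<^bsub>G\<^esub> = \<one>\<^bsub>A\<^esub>}"

definition system_of_choice ::
  "('g, 'n) monoid_scheme \<Rightarrow> ('k, 'a, 'p) module_scheme \<Rightarrow> ('g \<Rightarrow> 'g \<Rightarrow> 'g \<Rightarrow> 'k) \<Rightarrow>
   ('g \<Rightarrow> 'a) \<Rightarrow> ('k, 'g, 'a) qsystem" where
  "system_of_choice G A \<phi> c =
    \<lparr> qcoc = \<phi>,
      qact = (\<lambda>g x. (c g \<otimes>\<^bsub>A\<^esub> x) \<otimes>\<^bsub>A\<^esub> right_inv A (c g)),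
      qtwist = (\<lambda>g h. (c g \<otimes>\<^bsub>A\<^esub> c h) \<otimes>\<^bsub>A\<^esub> right_inv A (c (g \<otimes>\<^bsub>G\<^esub> h))) \<rparr>"

text \<open>
  The class of the system of any choice of units; as this class is the same for all choices,
  the union below is that one class.
\<close>

definition determined_class ::
  "('k, 'm) ring_scheme \<Rightarrow> ('g, 'n) monoid_scheme \<Rightarrow> ('k, 'a, 'p) module_scheme \<Rightarrow>
   ('g \<Rightarrow> 'a set) \<Rightarrow> ('g \<Rightarrow> 'g \<Rightarrow> 'g \<Rightarrow> 'k) \<Rightarrow> ('k, 'g, 'a) qsystem set" where
  "determined_class K G A gr \<phi> =
    (\<Union>c \<in> unit_choices G A gr.
      system_equiv K G (neutral_algebra G A gr) `` {system_of_choice G A \<phi> c})"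

end

theory Submission
  imports Defs
begin

text \<open>
  Let \<open>c g\<close> be homogeneous units of degree \<open>g\<close>. Since the cocycle is trivial as soon as one argument
  is \<open>e\<close>, the component \<open>A\<^sub>g\<close> is the free left \<open>A\<^sub>e\<close>-module on \<open>c g\<close>, and \<open>\<sigma>(g)(x)\<close> and
  \<open>\<alpha>(g,h)\<close> are the unique elements of \<open>A\<^sub>e\<close> with \<open>\<sigma>(g)(x) c g = c g x\<close> and
  \<open>\<alpha>(g,h) c (gh) = c g c h\<close>. An equivalence \<open>f\<close> preserves these relations, so \<open>c\<close> and \<open>f \<circ> c\<close> have
  the same system; the two cocycles agree because \<open>c g (c h c k) \<noteq> 0\<close>. Conversely, rescaling the
  units by \<open>u\<close> turns equivalent systems into equal ones, and for equal systems
  \<open>\<Sum> b\<^sub>g c g \<mapsto> \<Sum> b\<^sub>g d g\<close> is an equivalence, as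
  \<open>(b c g) (b' c h) = (b \<sigma>(g)(b') \<alpha>(g,h)) c (gh)\<close>.
\<close>

section \<open>Homogeneous components\<close>

text \<open>The main obstacle is that the left and the right inverse of a unit differ. If u is a
  unit of degree g with right inverse w, then w u is not 1 but the scalar \<phi>(g^-1,g,g^-1), so
  dividing by u with w and multiplying back by u is not obviously the identity. Rewriting (y w) u as
  a multiple of y (w u) costs a second scalar \<phi>(g,g^-1,g), and the cocycle identity at
  (g,g^-1,g,g^-1) makes the two scalars inverse to each other. This is why A_g equals A_e u although
  \<sigma> and \<alpha> are written with right inverses. Identities among the values of \<sigma> and
  \<alpha> are then tested after multiplication by a homogeneous unit, where brackets move freely
  past factors of degree e; \<phi> appears only in the condition on \<alpha> with three indices. A
  second point is that A'_e = A_e means agreement of the operations on the carrier only. Systems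
  over the two are therefore compared pointwise on A_e, never as records.\<close>

lemma (in unital_algebra) mult_zero_l: "x \<in> carrier A \<Longrightarrow> \<zero>\<^bsub>A\<^esub> \<otimes>\<^bsub>A\<^esub> x = \<zero>\<^bsub>A\<^esub>"
  using smult_mult_l[of "\<zero>\<^bsub>K\<^esub>" "\<zero>\<^bsub>A\<^esub>" x] mult_closed by simp

lemma (in unital_algebra) mult_zero_r: "x \<in> carrier A \<Longrightarrow> x \<otimes>\<^bsub>A\<^esub> \<zero>\<^bsub>A\<^esub> = \<zero>\<^bsub>A\<^esub>"
  using smult_mult_r[of "\<zero>\<^bsub>K\<^esub>" x "\<zero>\<^bsub>A\<^esub>"] mult_closed by simp

lemma (in unital_algebra) algebra_one_neq_zero: "\<one>\<^bsub>A\<^esub> \<noteq> \<zero>\<^bsub>A\<^esub>"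
proof
  assume eq: "\<one>\<^bsub>A\<^esub> = \<zero>\<^bsub>A\<^esub>"
  have "x = \<zero>\<^bsub>A\<^esub>" if "x \<in> carrier A" for x
    using unit_l[OF that] mult_zero_l[OF that] eq by simp
  then show False using nonzero by auto
qed

lemma (in unital_algebra) smult_Units_cancel:
  assumes "s \<in> Units K" "x \<in> carrier A" "y \<in> carrier A" "s \<odot>\<^bsub>A\<^esub> x = s \<odot>\<^bsub>A\<^esub> y"
  shows "x = y"
proof -
  have s: "s \<in> carrier K" "inv\<^bsub>K\<^esub> s \<in> carrier K" "inv\<^bsub>K\<^esub> s \<otimes>\<^bsub>K\<^esub> s = \<one>\<^bsub>K\<^esub>"
    using K.Units_closed[OF assms(1)] K.Units_inv_closed[OF assms(1)] K.Units_l_inv[OF assms(1)] by - assumption+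
  have "x = inv\<^bsub>K\<^esub> s \<odot>\<^bsub>A\<^esub> (s \<odot>\<^bsub>A\<^esub> x)"
    using s assms(2,3) by (simp flip: smult_assoc1)
  also have "\<dots> = inv\<^bsub>K\<^esub> s \<odot>\<^bsub>A\<^esub> (s \<odot>\<^bsub>A\<^esub> y)"
    using assms(4) by simp
  also have "\<dots> = y"
    using s assms(2,3) by (simp flip: smult_assoc1)
  finally show ?thesis .
qed

text \<open>A nonzero difference of \<open>s\<close> and \<open>t\<close> would be a unit of the
  field and would annihilate \<open>x\<close>. This is how two cocycle values are compared later, on
  a single nonzero element.\<close>

lemma (in unital_algebra) smult_scalar_cancel:
  assumes "s \<in> carrier K" "t \<in> carrier K" "x \<in> carrier A" "x \<noteq> \<zero>\<^bsub>A\<^esub>"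
    and eq: "s \<odot>\<^bsub>A\<^esub> x = t \<odot>\<^bsub>A\<^esub> x"
  shows "s = t"
proof (rule ccontr)
  assume "s \<noteq> t"
  then have "s \<ominus>\<^bsub>K\<^esub> t \<in> Units K"
    using assms(1,2) K.r_right_minus_eq by (auto simp: K.field_Units)
  moreover have "(s \<ominus>\<^bsub>K\<^esub> t) \<odot>\<^bsub>A\<^esub> x = (s \<ominus>\<^bsub>K\<^esub> t) \<odot>\<^bsub>A\<^esub> \<zero>\<^bsub>A\<^esub>"
    using assms by (simp add: K.minus_eq smult_l_distr smult_l_minus M.r_neg)
  ultimately show False
    using smult_Units_cancel assms(3,4) M.zero_closed by blast
qed

context graded_algebra
begin

lemma gr_carrier: "g \<in> carrier G \<Longrightarrow> x \<in> gr g \<Longrightarrow> x \<in> carrier A"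
  using submoduleE(1)[OF gr_submodule] by blast

lemma gr_zero: "g \<in> carrier G \<Longrightarrow> \<zero>\<^bsub>A\<^esub> \<in> gr g"
  using submodule.axioms(1)[OF gr_submodule, THEN subgroup.one_closed] by simp

lemma gr_add: "g \<in> carrier G \<Longrightarrow> x \<in> gr g \<Longrightarrow> y \<in> gr g \<Longrightarrow> x \<oplus>\<^bsub>A\<^esub> y \<in> gr g"
  using submodule.axioms(1)[OF gr_submodule, THEN subgroup.m_closed] by simp

lemma gr_smult: "g \<in> carrier G \<Longrightarrow> a \<in> carrier K \<Longrightarrow> x \<in> gr g \<Longrightarrow> a \<odot>\<^bsub>A\<^esub> x \<in> gr g"
  using submodule.smult_closed[OF gr_submodule] .

text \<open>On \<open>carrier A\<close> the description is justified by
  \<open>gr_direct_sum\<close>. The family it picks is extensional, hence \<open>undefined\<close>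
  outside \<open>carrier G\<close>, so facts about its values ask for a degree in
  \<open>carrier G\<close>.\<close>

definition hcomp :: "'e \<Rightarrow> 'a \<Rightarrow> 'e" where
  "hcomp x = (THE f. f \<in> (\<Pi>\<^sub>E g\<in>carrier G. gr g) \<and> finite {g \<in> carrier G. f g \<noteq> \<zero>\<^bsub>A\<^esub>} \<and>
             x = finsum A f {g \<in> carrier G. f g \<noteq> \<zero>\<^bsub>A\<^esub>})"

abbreviation hsupp :: "'e \<Rightarrow> 'a set" where
  "hsupp x \<equiv> {g \<in> carrier G. hcomp x g \<noteq> \<zero>\<^bsub>A\<^esub>}"

lemma hcomp_props:
  assumes "x \<in> carrier A"
  shows hcomp_PiE: "hcomp x \<in> (\<Pi>\<^sub>E g\<in>carrier G. gr g)"
    and finite_hsupp: "finite (hsupp x)"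
    and hcomp_sum: "x = finsum A (hcomp x) (hsupp x)"
  using theI'[OF gr_direct_sum[OF assms]] unfolding hcomp_def by auto

lemma hcomp_gr: "x \<in> carrier A \<Longrightarrow> g \<in> carrier G \<Longrightarrow> hcomp x g \<in> gr g"
  using hcomp_PiE by (auto simp: PiE_iff)

lemma hcomp_carrier: "x \<in> carrier A \<Longrightarrow> g \<in> carrier G \<Longrightarrow> hcomp x g \<in> carrier A"
  using hcomp_gr gr_carrier by blast

text \<open>Terms outside the support vanish, so the index set may be enlarged. Two elements can
  then be summed over a common set of degrees.\<close>

lemma hcomp_sum_superset:
  assumes "x \<in> carrier A" "finite S" "hsupp x \<subseteq> S" "S \<subseteq> carrier G"
  shows "x = finsum A (hcomp x) S"
proof -
  have "finsum A (hcomp x) (hsupp x) = finsum A (hcomp x) S"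
    using assms by (intro M.add.finprod_mono_neutral_cong_left) (auto intro!: hcomp_carrier)
  then show ?thesis using hcomp_sum[OF assms(1)] by (rule trans[rotated])
qed

text \<open>The usable form of the uniqueness in \<open>gr_direct_sum\<close>: \<open>f\<close> need
  not be extensional and \<open>S\<close> may exceed its support. The components of homogeneous
  elements, sums and scalar multiples are found by exhibiting a family with the right sum.\<close>

lemma hcomp_unique:
  assumes f: "\<And>g. g \<in> carrier G \<Longrightarrow> f g \<in> gr g" and S: "finite S" "S \<subseteq> carrier G"
    and z: "\<And>g. g \<in> carrier G - S \<Longrightarrow> f g = \<zero>\<^bsub>A\<^esub>" and x: "x = finsum A f S"
    and g: "g \<in> carrier G"
  shows "hcomp x g = f g"
proof -
  \<comment> \<open>\<open>gr_direct_sum\<close> speaks of extensional families summed over exactly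
    their support, so \<open>f\<close> is cut down to \<open>carrier G\<close> and \<open>S\<close>
    to \<open>?T\<close>.\<close>
  let ?f = "restrict f (carrier G)"
  let ?T = "{g \<in> carrier G. ?f g \<noteq> \<zero>\<^bsub>A\<^esub>}"
  have T: "?T \<subseteq> S" using z by auto
  have fc: "f \<in> S \<rightarrow> carrier A" using f S gr_carrier by blast
  have xc: "x \<in> carrier A" using fc x by simp
  have "finsum A ?f ?T = x"
    unfolding x
  proof (rule M.add.finprod_mono_neutral_cong_left[OF S(1) T])
    show "f i = \<zero>\<^bsub>A\<^esub>" if "i \<in> S - ?T" for i
      using that S(2) by auto
  qed (use fc in auto)
  moreover have "?f \<in> (\<Pi>\<^sub>E g\<in>carrier G. gr g)"
    using f by simp
  ultimately have "?f \<in> (\<Pi>\<^sub>E g\<in>carrier G. gr g) \<and> finite ?T \<and> x = finsum A ?f ?T"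
    using finite_subset[OF T S(1)] by (intro conjI) simp_all
  then have "hcomp x = ?f"
    unfolding hcomp_def by (rule the1_equality[OF gr_direct_sum[OF xc]])
  then show ?thesis using g by simp
qed

lemma hcomp_hom:
  assumes "g \<in> carrier G" "x \<in> gr g" "h \<in> carrier G"
  shows "hcomp x h = (if h = g then x else \<zero>\<^bsub>A\<^esub>)"
proof (rule hcomp_unique[where S = "{g}"])
  show "x = finsum A (\<lambda>h. if h = g then x else \<zero>\<^bsub>A\<^esub>) {g}"
    using assms gr_carrier by (subst M.finsum_insert) auto
qed (use assms gr_zero in auto)

lemma hcomp_add:
  assumes x: "x \<in> carrier A" and y: "y \<in> carrier A" and "g \<in> carrier G"
  shows "hcomp (x \<oplus>\<^bsub>A\<^esub> y) g = hcomp x g \<oplus>\<^bsub>A\<^esub> hcomp y g"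
proof (rule hcomp_unique[where S = "hsupp x \<union> hsupp y"])
  let ?S = "hsupp x \<union> hsupp y"
  have "finsum A (hcomp x) ?S = x" "finsum A (hcomp y) ?S = y"
    using x y finite_hsupp by (auto intro!: hcomp_sum_superset[symmetric])
  moreover have "finsum A (\<lambda>g. hcomp x g \<oplus>\<^bsub>A\<^esub> hcomp y g) ?S
      = finsum A (hcomp x) ?S \<oplus>\<^bsub>A\<^esub> finsum A (hcomp y) ?S"
    using x y by (intro M.finsum_addf) (auto intro!: hcomp_carrier)
  ultimately show "x \<oplus>\<^bsub>A\<^esub> y = finsum A (\<lambda>g. hcomp x g \<oplus>\<^bsub>A\<^esub> hcomp y g) ?S" by simp
qed (use assms finite_hsupp in \<open>auto intro!: gr_add hcomp_gr\<close>)

lemma hcomp_smult: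
  assumes a: "a \<in> carrier K" and x: "x \<in> carrier A" and "g \<in> carrier G"
  shows "hcomp (a \<odot>\<^bsub>A\<^esub> x) g = a \<odot>\<^bsub>A\<^esub> hcomp x g"
proof (rule hcomp_unique[where S = "hsupp x"])
  have "a \<odot>\<^bsub>A\<^esub> finsum A (hcomp x) (hsupp x) = finsum A (\<lambda>g. a \<odot>\<^bsub>A\<^esub> hcomp x g) (hsupp x)"
    using a x finite_hsupp by (intro finsum_smult_ldistr) (auto intro!: hcomp_carrier)
  then show "a \<odot>\<^bsub>A\<^esub> x = finsum A (\<lambda>g. a \<odot>\<^bsub>A\<^esub> hcomp x g) (hsupp x)"
    by (simp flip: hcomp_sum[OF x])
qed (use assms finite_hsupp in \<open>auto intro!: gr_smult hcomp_gr\<close>)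

lemma hcomp_eqI:
  assumes x: "x \<in> carrier A" and y: "y \<in> carrier A"
    and eq: "\<And>g. g \<in> carrier G \<Longrightarrow> hcomp x g = hcomp y g"
  shows "x = y"
proof -
  have "x = finsum A (hcomp x) (hsupp x)" by (rule hcomp_sum[OF x])
  also have "\<dots> = finsum A (hcomp y) (hsupp y)"
    using eq y by (intro M.add.finprod_cong') (auto intro!: hcomp_carrier)
  also have "\<dots> = y" by (rule hcomp_sum[OF y, symmetric])
  finally show ?thesis .
qed

text \<open>Every element is the sum of its finitely many components. The empty sum falls under the
  homogeneous case, because 0 has degree e, so zero is not a case of its own.\<close>

lemma hom_induct [consumes 1, case_names hom add]:
  assumes x: "x \<in> carrier A"
    and hom: "\<And>g x. g \<in> carrier G \<Longrightarrow> x \<in> gr g \<Longrightarrow> P x"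
    and add: "\<And>x y. x \<in> carrier A \<Longrightarrow> y \<in> carrier A \<Longrightarrow> P x \<Longrightarrow> P y \<Longrightarrow> P (x \<oplus>\<^bsub>A\<^esub> y)"
  shows "P x"
proof -
  have "S \<subseteq> carrier G \<Longrightarrow> P (finsum A (hcomp x) S)" if "finite S" for S
    using that
  proof (induction S)
    case empty
    show ?case using hom[OF G.one_closed gr_zero[OF G.one_closed]] by simp
  next
    case (insert g S)
    have c: "hcomp x \<in> S \<rightarrow> carrier A" "hcomp x g \<in> carrier A"
      using insert.prems x hcomp_carrier by auto
    have "P (hcomp x g)"
      using insert.prems x by (intro hom[of g] hcomp_gr) auto
    then have "P (hcomp x g \<oplus>\<^bsub>A\<^esub> finsum A (hcomp x) S)"
      using insert c by (intro add) auto
    then show ?case using insert c by (simp add: M.finsum_insert)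
  qed
  from this[OF finite_hsupp[OF x]] show ?thesis
    by (simp flip: hcomp_sum[OF x])
qed

text \<open>Multiplication by \<open>u\<close> moves degree k to gk, and gk = gh forces k = h. So
  only the component of \<open>x\<close> of degree \<open>h\<close> contributes to degree
  gh.\<close>

lemma hcomp_mult_l:
  assumes g: "g \<in> carrier G" "u \<in> gr g" and x: "x \<in> carrier A" and h: "h \<in> carrier G"
  shows "hcomp (u \<otimes>\<^bsub>A\<^esub> x) (g \<otimes>\<^bsub>G\<^esub> h) = u \<otimes>\<^bsub>A\<^esub> hcomp x h"
  using x
proof (induction x rule: hom_induct)
  case (hom k x)
  then show ?case
    using g h hcomp_hom[of k x h] hcomp_hom[OF _ gr_mult[OF g(1) hom(1) g(2) hom(2)], of "g \<otimes>\<^bsub>G\<^esub> h"]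
    by (auto simp: mult_zero_r gr_carrier)
next
  case (add x y)
  then show ?case
    using g h by (simp add: gr_carrier mult_r_distr mult_closed hcomp_add hcomp_carrier)
qed

lemma hcomp_mult_r:
  assumes g: "g \<in> carrier G" "u \<in> gr g" and x: "x \<in> carrier A" and h: "h \<in> carrier G"
  shows "hcomp (x \<otimes>\<^bsub>A\<^esub> u) (h \<otimes>\<^bsub>G\<^esub> g) = hcomp x h \<otimes>\<^bsub>A\<^esub> u"
  using x
proof (induction x rule: hom_induct)
  case (hom k x)
  then show ?case
    using g h hcomp_hom[of k x h] hcomp_hom[OF _ gr_mult[OF hom(1) g(1) hom(2) g(2)], of "h \<otimes>\<^bsub>G\<^esub> g"]
    by (auto simp: mult_zero_l gr_carrier)
next
  case (add x y)
  then show ?case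
    using g h by (simp add: gr_carrier mult_l_distr mult_closed hcomp_add hcomp_carrier)
qed

text \<open>The degree \<open>e\<close> component of \<open>1\<close> acts as a left identity on homogeneous elements, so it is \<open>1\<close>.\<close>

lemma one_gr: "\<one>\<^bsub>A\<^esub> \<in> gr \<one>\<^bsub>G\<^esub>"
proof -
  let ?e = "hcomp \<one>\<^bsub>A\<^esub> \<one>\<^bsub>G\<^esub>"
  have e: "?e \<in> gr \<one>\<^bsub>G\<^esub>" "?e \<in> carrier A"
    using hcomp_gr hcomp_carrier unit_closed by auto
  have "?e \<otimes>\<^bsub>A\<^esub> x = x" if "x \<in> carrier A" for x
    using that
  proof (induction x rule: hom_induct)
    case (hom g x)
    have "hcomp (\<one>\<^bsub>A\<^esub> \<otimes>\<^bsub>A\<^esub> x) (\<one>\<^bsub>G\<^esub> \<otimes>\<^bsub>G\<^esub> g) = ?e \<otimes>\<^bsub>A\<^esub> x"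
      using hom unit_closed by (intro hcomp_mult_r) auto
    then show ?case
      using hom hcomp_hom[of g x g] by (simp add: unit_l gr_carrier)
  next
    case (add x y)
    then show ?case using e by (simp add: mult_r_distr)
  qed
  from this[OF unit_closed] show ?thesis using e unit_r by simp
qed

end

section \<open>Extending homogeneous isomorphisms\<close>

text \<open>The extension sums the values of \<open>F\<close> over the components of its argument.
  \<open>F\<close> takes the degree as a parameter because the maps used later divide by a unit that
  depends on the degree.\<close>

lemma graded_linear_extension:
  fixes K :: "('k, 'm) ring_scheme" and G :: "('g, 'n) monoid_scheme"
    and A :: "('k, 'a, 'p) module_scheme" and A' :: "('k, 'b, 'q) module_scheme"
  assumes A: "graded_algebra K G A gr" and A': "graded_algebra K G A' gr'"
    and F: "\<And>g x. g \<in> carrier G \<Longrightarrow> x \<in> gr g \<Longrightarrow> F g x \<in> gr' g"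
    and Fadd: "\<And>g x y. g \<in> carrier G \<Longrightarrow> x \<in> gr g \<Longrightarrow> y \<in> gr g \<Longrightarrow>
      F g (x \<oplus>\<^bsub>A\<^esub> y) = F g x \<oplus>\<^bsub>A'\<^esub> F g y"
    and Fsmult: "\<And>g a x. g \<in> carrier G \<Longrightarrow> a \<in> carrier K \<Longrightarrow> x \<in> gr g \<Longrightarrow>
      F g (a \<odot>\<^bsub>A\<^esub> x) = a \<odot>\<^bsub>A'\<^esub> F g x"
  obtains f where "\<And>x. x \<in> carrier A \<Longrightarrow> f x \<in> carrier A'"
    and "\<And>x y. x \<in> carrier A \<Longrightarrow> y \<in> carrier A \<Longrightarrow> f (x \<oplus>\<^bsub>A\<^esub> y) = f x \<oplus>\<^bsub>A'\<^esub> f y"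
    and "\<And>a x. a \<in> carrier K \<Longrightarrow> x \<in> carrier A \<Longrightarrow> f (a \<odot>\<^bsub>A\<^esub> x) = a \<odot>\<^bsub>A'\<^esub> f x"
    and "\<And>g x. g \<in> carrier G \<Longrightarrow> x \<in> gr g \<Longrightarrow> f x = F g x"
proof -
  interpret A: graded_algebra K G A gr by (rule A)
  interpret A': graded_algebra K G A' gr' by (rule A')
  define f where "f x = finsum A' (\<lambda>g. F g (A.hcomp x g)) (A.hsupp x)" for x
  \<comment> \<open>Linearity with the scalar 0 gives the value at 0. This allows padding the
    support with further degrees in \<open>f_superset\<close>.\<close>
  have F0: "F g \<zero>\<^bsub>A\<^esub> = \<zero>\<^bsub>A'\<^esub>" if "g \<in> carrier G" for g
    using Fsmult[OF that A.K.zero_closed A.gr_zero[OF that]] F[OF that A.gr_zero[OF that]]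
      A'.gr_carrier[OF that] by simp
  have Fc: "F g (A.hcomp x g) \<in> carrier A'" if "g \<in> carrier G" "x \<in> carrier A" for g x
    using that F A.hcomp_gr A'.gr_carrier by blast
  have f_superset: "f x = finsum A' (\<lambda>g. F g (A.hcomp x g)) S"
    if "x \<in> carrier A" "finite S" "A.hsupp x \<subseteq> S" "S \<subseteq> carrier G" for x S
    unfolding f_def using that F0 Fc
    by (intro A'.M.add.finprod_mono_neutral_cong_left) (auto simp: subset_eq)
  show thesis
  proof
    show "f x \<in> carrier A'" if "x \<in> carrier A" for x
      unfolding f_def using Fc that by (intro A'.M.finsum_closed) auto
    show "f (x \<oplus>\<^bsub>A\<^esub> y) = f x \<oplus>\<^bsub>A'\<^esub> f y" if x: "x \<in> carrier A" and y: "y \<in> carrier A" for x y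
    proof -
      let ?S = "A.hsupp x \<union> A.hsupp y"
      have S: "finite ?S" "?S \<subseteq> carrier G" using A.finite_hsupp x y by auto
      have "f (x \<oplus>\<^bsub>A\<^esub> y) = finsum A' (\<lambda>g. F g (A.hcomp (x \<oplus>\<^bsub>A\<^esub> y) g)) ?S"
        using x y S by (intro f_superset) (auto simp: A.hcomp_add)
      also have "\<dots> = finsum A' (\<lambda>g. F g (A.hcomp x g) \<oplus>\<^bsub>A'\<^esub> F g (A.hcomp y g)) ?S"
        using x y S Fc by (intro A'.M.add.finprod_cong') (auto simp: A.hcomp_add Fadd A.hcomp_gr)
      also have "\<dots> = finsum A' (\<lambda>g. F g (A.hcomp x g)) ?S \<oplus>\<^bsub>A'\<^esub> finsum A' (\<lambda>g. F g (A.hcomp y g)) ?S"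
        using x y S Fc by (intro A'.M.finsum_addf) auto
      also have "\<dots> = f x \<oplus>\<^bsub>A'\<^esub> f y"
        using x y S f_superset[of _ ?S] by auto
      finally show ?thesis .
    qed
    show "f (a \<odot>\<^bsub>A\<^esub> x) = a \<odot>\<^bsub>A'\<^esub> f x" if a: "a \<in> carrier K" and x: "x \<in> carrier A" for a x
    proof -
      have "f (a \<odot>\<^bsub>A\<^esub> x) = finsum A' (\<lambda>g. F g (A.hcomp (a \<odot>\<^bsub>A\<^esub> x) g)) (A.hsupp x)"
        using a x A.finite_hsupp by (intro f_superset) (auto simp: A.hcomp_smult)
      also have "\<dots> = finsum A' (\<lambda>g. a \<odot>\<^bsub>A'\<^esub> F g (A.hcomp x g)) (A.hsupp x)"
        using a x Fc by (intro A'.M.add.finprod_cong') (auto simp: A.hcomp_smult Fsmult A.hcomp_gr)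
      also have "\<dots> = a \<odot>\<^bsub>A'\<^esub> f x"
        unfolding f_def using a x Fc A.finite_hsupp
        by (intro A'.finsum_smult_ldistr[symmetric]) auto
      finally show ?thesis .
    qed
    show "f x = F g x" if g: "g \<in> carrier G" and x: "x \<in> gr g" for g x
    proof -
      have "f x = finsum A' (\<lambda>h. F h (A.hcomp x h)) {g}"
        using g x A.gr_carrier by (intro f_superset) (auto simp: A.hcomp_hom split: if_splits)
      also have "\<dots> = F g (A.hcomp x g)"
        using Fc[OF g A.gr_carrier[OF g x]] by (subst A'.M.finsum_insert) auto
      finally show ?thesis using A.hcomp_hom[OF g x g] by simp
    qed
  qed
qed

text \<open>Linear extensions of \<open>F\<close> and \<open>F'\<close> are inverse to each other as
  soon as this holds on homogeneous elements, and by bilinearity products need checking on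
  homogeneous pairs only. Linearity of \<open>F'\<close> is inherited from \<open>F\<close>, whose
  inverse it is in each degree.\<close>

lemma graded_iso_extension:
  fixes K :: "('k, 'm) ring_scheme" and G :: "('g, 'n) monoid_scheme"
    and A :: "('k, 'a, 'p) module_scheme" and A' :: "('k, 'b, 'q) module_scheme"
  assumes A: "graded_algebra K G A gr" and A': "graded_algebra K G A' gr'"
    and F: "\<And>g x. g \<in> carrier G \<Longrightarrow> x \<in> gr g \<Longrightarrow> F g x \<in> gr' g"
    and F': "\<And>g x. g \<in> carrier G \<Longrightarrow> x \<in> gr' g \<Longrightarrow> F' g x \<in> gr g"
    and F'F: "\<And>g x. g \<in> carrier G \<Longrightarrow> x \<in> gr g \<Longrightarrow> F' g (F g x) = x"
    and FF': "\<And>g x. g \<in> carrier G \<Longrightarrow> x \<in> gr' g \<Longrightarrow> F g (F' g x) = x"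
    and Fadd: "\<And>g x y. g \<in> carrier G \<Longrightarrow> x \<in> gr g \<Longrightarrow> y \<in> gr g \<Longrightarrow>
      F g (x \<oplus>\<^bsub>A\<^esub> y) = F g x \<oplus>\<^bsub>A'\<^esub> F g y"
    and Fsmult: "\<And>g a x. g \<in> carrier G \<Longrightarrow> a \<in> carrier K \<Longrightarrow> x \<in> gr g \<Longrightarrow>
      F g (a \<odot>\<^bsub>A\<^esub> x) = a \<odot>\<^bsub>A'\<^esub> F g x"
    and Fmult: "\<And>g h x y. g \<in> carrier G \<Longrightarrow> h \<in> carrier G \<Longrightarrow> x \<in> gr g \<Longrightarrow> y \<in> gr h \<Longrightarrow>
      F (g \<otimes>\<^bsub>G\<^esub> h) (x \<otimes>\<^bsub>A\<^esub> y) = F g x \<otimes>\<^bsub>A'\<^esub> F h y"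
    and Fone: "F \<one>\<^bsub>G\<^esub> \<one>\<^bsub>A\<^esub> = \<one>\<^bsub>A'\<^esub>"
  obtains f where "f \<in> algebra_iso K A A'"
    and "\<And>g x. g \<in> carrier G \<Longrightarrow> x \<in> gr g \<Longrightarrow> f x = F g x"
proof -
  interpret A: graded_algebra K G A gr by (rule A)
  interpret A': graded_algebra K G A' gr' by (rule A')
  obtain f where f: "\<And>x. x \<in> carrier A \<Longrightarrow> f x \<in> carrier A'"
    and fadd: "\<And>x y. x \<in> carrier A \<Longrightarrow> y \<in> carrier A \<Longrightarrow> f (x \<oplus>\<^bsub>A\<^esub> y) = f x \<oplus>\<^bsub>A'\<^esub> f y"
    and fsmult: "\<And>a x. a \<in> carrier K \<Longrightarrow> x \<in> carrier A \<Longrightarrow> f (a \<odot>\<^bsub>A\<^esub> x) = a \<odot>\<^bsub>A'\<^esub> f x"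
    and fF: "\<And>g x. g \<in> carrier G \<Longrightarrow> x \<in> gr g \<Longrightarrow> f x = F g x"
    by (rule graded_linear_extension[OF A A', of F]) (use F Fadd Fsmult in auto)
  have F'add: "F' g (x \<oplus>\<^bsub>A'\<^esub> y) = F' g x \<oplus>\<^bsub>A\<^esub> F' g y"
    if "g \<in> carrier G" "x \<in> gr' g" "y \<in> gr' g" for g x y
    using that F'F[of g "F' g x \<oplus>\<^bsub>A\<^esub> F' g y"] by (simp add: Fadd F' FF' A.gr_add)
  have F'smult: "F' g (a \<odot>\<^bsub>A'\<^esub> x) = a \<odot>\<^bsub>A\<^esub> F' g x"
    if "g \<in> carrier G" "a \<in> carrier K" "x \<in> gr' g" for g a x
    using that F'F[of g "a \<odot>\<^bsub>A\<^esub> F' g x"] by (simp add: Fsmult F' FF' A.gr_smult)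
  obtain f' where f': "\<And>x. x \<in> carrier A' \<Longrightarrow> f' x \<in> carrier A"
    and f'add: "\<And>x y. x \<in> carrier A' \<Longrightarrow> y \<in> carrier A' \<Longrightarrow> f' (x \<oplus>\<^bsub>A'\<^esub> y) = f' x \<oplus>\<^bsub>A\<^esub> f' y"
    and f'smult: "\<And>a x. a \<in> carrier K \<Longrightarrow> x \<in> carrier A' \<Longrightarrow> f' (a \<odot>\<^bsub>A'\<^esub> x) = a \<odot>\<^bsub>A\<^esub> f' x"
    and f'F': "\<And>g x. g \<in> carrier G \<Longrightarrow> x \<in> gr' g \<Longrightarrow> f' x = F' g x"
    by (rule graded_linear_extension[OF A' A, of F']) (use F' F'add F'smult in auto)
  have f'f: "f' (f x) = x" if "x \<in> carrier A" for x
    using that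
  proof (induction x rule: A.hom_induct)
    case (hom g x)
    then show ?case using F F'F by (simp add: fF f'F')
  qed (simp add: fadd f'add f)
  have ff': "f (f' x) = x" if "x \<in> carrier A'" for x
    using that
  proof (induction x rule: A'.hom_induct)
    case (hom g x)
    then show ?case using F' FF' by (simp add: fF f'F')
  qed (simp add: fadd f'add f')
  have fmult: "f (x \<otimes>\<^bsub>A\<^esub> y) = f x \<otimes>\<^bsub>A'\<^esub> f y" if "x \<in> carrier A" "y \<in> carrier A" for x y
    using that
  proof (induction x rule: A.hom_induct)
    case (hom g x)
    from hom(3) show ?case
    proof (induction y rule: A.hom_induct)
      case (hom h y)
      then show ?case
        using \<open>g \<in> carrier G\<close> \<open>x \<in> gr g\<close> Fmult[of g h x y]
        by (simp add: fF[OF A.G.m_closed A.gr_mult] fF)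
    next
      case (add y z)
      then show ?case
        using A.gr_carrier[OF \<open>g \<in> carrier G\<close> \<open>x \<in> gr g\<close>]
        by (simp add: fadd f A.mult_r_distr A'.mult_r_distr A.mult_closed)
    qed
  next
    case (add x z)
    then show ?case
      by (simp add: fadd f A.mult_l_distr A'.mult_l_distr A.mult_closed)
  qed
  have "bij_betw f (carrier A) (carrier A')"
    using f f' f'f ff' by (intro bij_betwI[where g = f']) auto
  moreover have "f \<in> ring_hom A A'"
    using f fadd fmult fF[OF A.G.one_closed A.one_gr] Fone by (intro ring_hom_memI) auto
  ultimately have "f \<in> algebra_iso K A A'"
    using fsmult by (auto simp: algebra_iso_def ring_iso_def)
  then show thesis using that fF by blast
qed

section \<open>Homogeneous units of graded quasialgebras\<close>

context graded_quasialgebra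
begin

lemmas gr_carrier' = gr_carrier[rotated]

section \<open>Values of the cocycle at the neutral element and at inverse pairs\<close>

lemma phi_Units:
  "g \<in> carrier G \<Longrightarrow> h \<in> carrier G \<Longrightarrow> k \<in> carrier G \<Longrightarrow> \<phi> g h k \<in> Units K"
  using cocycle unfolding cocycle_def by blast

lemma phi_closed:
  "g \<in> carrier G \<Longrightarrow> h \<in> carrier G \<Longrightarrow> k \<in> carrier G \<Longrightarrow> \<phi> g h k \<in> carrier K"
  using phi_Units K.Units_closed by blast

lemma phi_cocycle:
  "g \<in> carrier G \<Longrightarrow> h \<in> carrier G \<Longrightarrow> k \<in> carrier G \<Longrightarrow> l \<in> carrier G \<Longrightarrow>
    \<phi> h k l \<otimes>\<^bsub>K\<^esub> \<phi> g (h \<otimes>\<^bsub>G\<^esub> k) l \<otimes>\<^bsub>K\<^esub> \<phi> g h k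
      = \<phi> g h (k \<otimes>\<^bsub>G\<^esub> l) \<otimes>\<^bsub>K\<^esub> \<phi> (g \<otimes>\<^bsub>G\<^esub> h) k l"
  using cocycle unfolding cocycle_def by blast

lemma phi_mid: "g \<in> carrier G \<Longrightarrow> h \<in> carrier G \<Longrightarrow> \<phi> g \<one>\<^bsub>G\<^esub> h = \<one>\<^bsub>K\<^esub>"
  using cocycle unfolding cocycle_def by blast

text \<open>The cocycle identity at (e,e,g,h) says that \<phi>(e,g,h) equals its own square, and a
  unit with this property is 1.\<close>

lemma phi_left:
  assumes "g \<in> carrier G" "h \<in> carrier G"
  shows "\<phi> \<one>\<^bsub>G\<^esub> g h = \<one>\<^bsub>K\<^esub>"
proof -
  have "\<phi> \<one>\<^bsub>G\<^esub> g h \<otimes>\<^bsub>K\<^esub> \<phi> \<one>\<^bsub>G\<^esub> g h = \<phi> \<one>\<^bsub>G\<^esub> g h"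
    using phi_cocycle[of "\<one>\<^bsub>G\<^esub>" "\<one>\<^bsub>G\<^esub>" g h] assms by (simp add: phi_mid phi_closed)
  then show ?thesis
    using K.Units_l_cancel[OF phi_Units, of "\<one>\<^bsub>G\<^esub>" g h "\<phi> \<one>\<^bsub>G\<^esub> g h" "\<one>\<^bsub>K\<^esub>"] assms
    by (simp add: phi_closed)
qed

text \<open>The same argument with the cocycle identity at (g,h,e,e).\<close>

lemma phi_right:
  assumes "g \<in> carrier G" "h \<in> carrier G"
  shows "\<phi> g h \<one>\<^bsub>G\<^esub> = \<one>\<^bsub>K\<^esub>"
proof -
  have "\<phi> g h \<one>\<^bsub>G\<^esub> \<otimes>\<^bsub>K\<^esub> \<phi> g h \<one>\<^bsub>G\<^esub> = \<phi> g h \<one>\<^bsub>G\<^esub>"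
    using phi_cocycle[of g h "\<one>\<^bsub>G\<^esub>" "\<one>\<^bsub>G\<^esub>"] assms by (simp add: phi_mid phi_closed)
  then show ?thesis
    using K.Units_l_cancel[OF phi_Units, of g h "\<one>\<^bsub>G\<^esub>" "\<phi> g h \<one>\<^bsub>G\<^esub>" "\<one>\<^bsub>K\<^esub>"] assms
    by (simp add: phi_closed)
qed

text \<open>In the cocycle identity at (g,g^-1,g,g^-1) every factor except these two has the
  argument e.\<close>

lemma phi_inv:
  assumes "g \<in> carrier G"
  shows "\<phi> (inv\<^bsub>G\<^esub> g) g (inv\<^bsub>G\<^esub> g) \<otimes>\<^bsub>K\<^esub> \<phi> g (inv\<^bsub>G\<^esub> g) g = \<one>\<^bsub>K\<^esub>"
  using phi_cocycle[of g "inv\<^bsub>G\<^esub> g" g "inv\<^bsub>G\<^esub> g"] assms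
  by (simp add: phi_mid phi_left phi_right phi_closed)

lemma assoc_left:
  "h \<in> carrier G \<Longrightarrow> k \<in> carrier G \<Longrightarrow> x \<in> gr \<one>\<^bsub>G\<^esub> \<Longrightarrow> y \<in> gr h \<Longrightarrow> z \<in> gr k \<Longrightarrow>
    (x \<otimes>\<^bsub>A\<^esub> y) \<otimes>\<^bsub>A\<^esub> z = x \<otimes>\<^bsub>A\<^esub> (y \<otimes>\<^bsub>A\<^esub> z)"
  using quasi_assoc[of "\<one>\<^bsub>G\<^esub>" h k x y z] by (simp add: phi_left mult_closed gr_carrier')

lemma assoc_mid:
  "g \<in> carrier G \<Longrightarrow> k \<in> carrier G \<Longrightarrow> x \<in> gr g \<Longrightarrow> y \<in> gr \<one>\<^bsub>G\<^esub> \<Longrightarrow> z \<in> gr k \<Longrightarrow>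
    (x \<otimes>\<^bsub>A\<^esub> y) \<otimes>\<^bsub>A\<^esub> z = x \<otimes>\<^bsub>A\<^esub> (y \<otimes>\<^bsub>A\<^esub> z)"
  using quasi_assoc[of g "\<one>\<^bsub>G\<^esub>" k x y z] by (simp add: phi_mid mult_closed gr_carrier')

lemma assoc_right:
  "g \<in> carrier G \<Longrightarrow> h \<in> carrier G \<Longrightarrow> x \<in> gr g \<Longrightarrow> y \<in> gr h \<Longrightarrow> z \<in> gr \<one>\<^bsub>G\<^esub> \<Longrightarrow>
    (x \<otimes>\<^bsub>A\<^esub> y) \<otimes>\<^bsub>A\<^esub> z = x \<otimes>\<^bsub>A\<^esub> (y \<otimes>\<^bsub>A\<^esub> z)"
  using quasi_assoc[of g h "\<one>\<^bsub>G\<^esub>" x y z] by (simp add: phi_right mult_closed gr_carrier')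

lemma gr_mult_one_l:
  "g \<in> carrier G \<Longrightarrow> x \<in> gr \<one>\<^bsub>G\<^esub> \<Longrightarrow> y \<in> gr g \<Longrightarrow> x \<otimes>\<^bsub>A\<^esub> y \<in> gr g"
  using gr_mult[of "\<one>\<^bsub>G\<^esub>" g x y] by simp

lemma gr_mult_one_r:
  "g \<in> carrier G \<Longrightarrow> x \<in> gr g \<Longrightarrow> y \<in> gr \<one>\<^bsub>G\<^esub> \<Longrightarrow> x \<otimes>\<^bsub>A\<^esub> y \<in> gr g"
  using gr_mult[of g "\<one>\<^bsub>G\<^esub>" x y] by simp

section \<open>Inverses of homogeneous units and division by them\<close>

abbreviation hunits :: "'c \<Rightarrow> 'e set" where
  "hunits g \<equiv> lr_units A \<inter> gr g"

text \<open>Since 1 has degree e, the component of degree g^-1 of any left inverse is already a left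
  inverse.\<close>

lemma hunit_left_inv:
  assumes g: "g \<in> carrier G" and u: "u \<in> hunits g"
  obtains v where "v \<in> gr (inv\<^bsub>G\<^esub> g)" "v \<otimes>\<^bsub>A\<^esub> u = \<one>\<^bsub>A\<^esub>"
proof -
  from u obtain v where v: "v \<in> carrier A" "v \<otimes>\<^bsub>A\<^esub> u = \<one>\<^bsub>A\<^esub>"
    unfolding lr_units_def by blast
  have "hcomp v (inv\<^bsub>G\<^esub> g) \<otimes>\<^bsub>A\<^esub> u = hcomp (v \<otimes>\<^bsub>A\<^esub> u) (inv\<^bsub>G\<^esub> g \<otimes>\<^bsub>G\<^esub> g)"
    using g u v by (intro hcomp_mult_r[symmetric]) auto
  also have "\<dots> = \<one>\<^bsub>A\<^esub>"
    using g v hcomp_hom[OF _ one_gr] by simp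
  finally show thesis
    by (rule that[OF hcomp_gr[OF v(1) G.inv_closed[OF g]]])
qed

lemma hunit_right_inv:
  assumes g: "g \<in> carrier G" and u: "u \<in> hunits g"
  obtains w where "w \<in> gr (inv\<^bsub>G\<^esub> g)" "u \<otimes>\<^bsub>A\<^esub> w = \<one>\<^bsub>A\<^esub>"
proof -
  from u obtain w where w: "w \<in> carrier A" "u \<otimes>\<^bsub>A\<^esub> w = \<one>\<^bsub>A\<^esub>"
    unfolding lr_units_def by blast
  have "u \<otimes>\<^bsub>A\<^esub> hcomp w (inv\<^bsub>G\<^esub> g) = hcomp (u \<otimes>\<^bsub>A\<^esub> w) (g \<otimes>\<^bsub>G\<^esub> inv\<^bsub>G\<^esub> g)"
    using g u w by (intro hcomp_mult_l[symmetric]) auto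
  also have "\<dots> = \<one>\<^bsub>A\<^esub>"
    using g w hcomp_hom[OF _ one_gr] by simp
  finally show thesis
    by (rule that[OF hcomp_gr[OF w(1) G.inv_closed[OF g]]])
qed

text \<open>With a left inverse v of \<open>u\<close>, an element z of degree \<open>h\<close> is
  recovered from \<open>u\<close> z as \<phi>(g^-1,g,h) v (u z). The scalar depends on
  \<open>h\<close>, which is why \<open>x\<close> and \<open>y\<close> are taken in the same
  degree.\<close>

lemma hunit_cancel:
  assumes g: "g \<in> carrier G" and u: "u \<in> hunits g" and h: "h \<in> carrier G"
    and x: "x \<in> gr h" and y: "y \<in> gr h" and eq: "u \<otimes>\<^bsub>A\<^esub> x = u \<otimes>\<^bsub>A\<^esub> y"
  shows "x = y"
proof -
  obtain v where v: "v \<in> gr (inv\<^bsub>G\<^esub> g)" "v \<otimes>\<^bsub>A\<^esub> u = \<one>\<^bsub>A\<^esub>"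
    using hunit_left_inv[OF g u] .
  have *: "z = \<phi> (inv\<^bsub>G\<^esub> g) g h \<odot>\<^bsub>A\<^esub> (v \<otimes>\<^bsub>A\<^esub> (u \<otimes>\<^bsub>A\<^esub> z))" if "z \<in> gr h" for z
    using quasi_assoc[of "inv\<^bsub>G\<^esub> g" g h v u z] that v g u h unit_l[OF gr_carrier[OF h that]] by auto
  show ?thesis
    by (subst *[OF x], subst *[OF y]) (simp add: eq)
qed

text \<open>The description in \<open>right_inv\<close> ranges over the whole carrier, so a
  competing right inverse may be inhomogeneous. Comparing components reduces its uniqueness to
  cancellation in each degree.\<close>

lemma right_inv_eq:
  assumes g: "g \<in> carrier G" and u: "u \<in> hunits g"
    and w: "w \<in> carrier A" "u \<otimes>\<^bsub>A\<^esub> w = \<one>\<^bsub>A\<^esub>"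
  shows "right_inv A u = w"
  unfolding right_inv_def
proof (rule the_equality)
  fix w' assume w': "w' \<in> carrier A \<and> u \<otimes>\<^bsub>A\<^esub> w' = \<one>\<^bsub>A\<^esub>"
  show "w' = w"
  proof (rule hcomp_eqI)
    fix h assume h: "h \<in> carrier G"
    have "u \<otimes>\<^bsub>A\<^esub> hcomp w' h = u \<otimes>\<^bsub>A\<^esub> hcomp w h"
      using g u w w' h hcomp_mult_l[of g u w h] hcomp_mult_l[of g u w' h] by simp
    then show "hcomp w' h = hcomp w h"
      using hunit_cancel[OF g u h] hcomp_gr w w' h by simp
  qed (use w w' in auto)
qed (use w in simp)

lemma right_inv_props:
  assumes g: "g \<in> carrier G" and u: "u \<in> hunits g"
  shows right_inv_gr: "right_inv A u \<in> gr (inv\<^bsub>G\<^esub> g)"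
    and mult_right_inv: "u \<otimes>\<^bsub>A\<^esub> right_inv A u = \<one>\<^bsub>A\<^esub>"
proof -
  obtain w where w: "w \<in> gr (inv\<^bsub>G\<^esub> g)" "u \<otimes>\<^bsub>A\<^esub> w = \<one>\<^bsub>A\<^esub>"
    using hunit_right_inv[OF g u] .
  then have "right_inv A u = w"
    using right_inv_eq[OF g u] gr_carrier[OF G.inv_closed[OF g]] by blast
  then show "right_inv A u \<in> gr (inv\<^bsub>G\<^esub> g)" "u \<otimes>\<^bsub>A\<^esub> right_inv A u = \<one>\<^bsub>A\<^esub>"
    using w by simp_all
qed

text \<open>Rebracketing (v u) w for a left inverse v and the right inverse w shows that w is a
  scalar multiple of v, and the scalar is the cocycle value in the claim.\<close>

lemma right_inv_mult:
  assumes g: "g \<in> carrier G" and u: "u \<in> hunits g"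
  shows "right_inv A u \<otimes>\<^bsub>A\<^esub> u = \<phi> (inv\<^bsub>G\<^esub> g) g (inv\<^bsub>G\<^esub> g) \<odot>\<^bsub>A\<^esub> \<one>\<^bsub>A\<^esub>"
proof -
  let ?s = "\<phi> (inv\<^bsub>G\<^esub> g) g (inv\<^bsub>G\<^esub> g)"
  obtain v where v: "v \<in> gr (inv\<^bsub>G\<^esub> g)" "v \<otimes>\<^bsub>A\<^esub> u = \<one>\<^bsub>A\<^esub>"
    using hunit_left_inv[OF g u] .
  have c: "u \<in> carrier A" "v \<in> carrier A" "right_inv A u \<in> carrier A"
    using g u v gr_carrier[OF G.inv_closed[OF g]] gr_carrier[OF g] right_inv_gr[OF g u] by auto
  have "right_inv A u = ?s \<odot>\<^bsub>A\<^esub> v"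
    using quasi_assoc[of "inv\<^bsub>G\<^esub> g" g "inv\<^bsub>G\<^esub> g" v u "right_inv A u"] g u v c right_inv_props[OF g u]
    by (simp add: unit_l unit_r)
  then show ?thesis
    using g c v by (simp add: smult_mult_l phi_closed)
qed

text \<open>Multiplying back yields the scalar \<phi>(g,g^-1,g) from moving the brackets and the one
  from \<open>right_inv_mult\<close>; by \<open>phi_inv\<close> their product is 1.\<close>

lemma hunit_div:
  assumes g: "g \<in> carrier G" and u: "u \<in> hunits g" and y: "y \<in> gr g"
  shows "y \<otimes>\<^bsub>A\<^esub> right_inv A u \<in> gr \<one>\<^bsub>G\<^esub>"
    and "(y \<otimes>\<^bsub>A\<^esub> right_inv A u) \<otimes>\<^bsub>A\<^esub> u = y"
proof -
  show "y \<otimes>\<^bsub>A\<^esub> right_inv A u \<in> gr \<one>\<^bsub>G\<^esub>"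
    using gr_mult[OF g _ y right_inv_gr[OF g u]] g by simp
  have "(y \<otimes>\<^bsub>A\<^esub> right_inv A u) \<otimes>\<^bsub>A\<^esub> u
      = \<phi> g (inv\<^bsub>G\<^esub> g) g \<odot>\<^bsub>A\<^esub> (y \<otimes>\<^bsub>A\<^esub> (\<phi> (inv\<^bsub>G\<^esub> g) g (inv\<^bsub>G\<^esub> g) \<odot>\<^bsub>A\<^esub> \<one>\<^bsub>A\<^esub>))"
    using quasi_assoc[of g "inv\<^bsub>G\<^esub> g" g y "right_inv A u" u] g u y right_inv_props[OF g u]
    by (simp add: right_inv_mult[OF g u])
  also have "\<dots> = (\<phi> g (inv\<^bsub>G\<^esub> g) g \<otimes>\<^bsub>K\<^esub> \<phi> (inv\<^bsub>G\<^esub> g) g (inv\<^bsub>G\<^esub> g)) \<odot>\<^bsub>A\<^esub> y"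
    using g y gr_carrier[OF g y] by (simp add: smult_mult_r smult_assoc1 phi_closed unit_closed unit_r)
  also have "\<dots> = y"
    using phi_inv[OF g] g y gr_carrier[OF g y] by (simp add: K.m_comm phi_closed)
  finally show "(y \<otimes>\<^bsub>A\<^esub> right_inv A u) \<otimes>\<^bsub>A\<^esub> u = y" .
qed

lemma hunit_mult_div:
  assumes g: "g \<in> carrier G" and u: "u \<in> hunits g" and b: "b \<in> gr \<one>\<^bsub>G\<^esub>"
  shows "(b \<otimes>\<^bsub>A\<^esub> u) \<otimes>\<^bsub>A\<^esub> right_inv A u = b"
proof -
  have "(b \<otimes>\<^bsub>A\<^esub> u) \<otimes>\<^bsub>A\<^esub> right_inv A u = b \<otimes>\<^bsub>A\<^esub> (u \<otimes>\<^bsub>A\<^esub> right_inv A u)"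
    using u by (intro assoc_left[OF g G.inv_closed[OF g] b _ right_inv_gr[OF g u]]) blast
  also have "\<dots> = b"
    unfolding mult_right_inv[OF g u] by (rule unit_r[OF gr_carrier[OF G.one_closed b]])
  finally show ?thesis .
qed

text \<open>Uniqueness of the coefficient in A_g = A_e u. The identities between elements of A_e
  that define a quasicrossed system are all derived through it.\<close>

lemma hunit_cancel_r:
  assumes "g \<in> carrier G" "u \<in> hunits g" "b \<in> gr \<one>\<^bsub>G\<^esub>" "b' \<in> gr \<one>\<^bsub>G\<^esub>"
    and "b \<otimes>\<^bsub>A\<^esub> u = b' \<otimes>\<^bsub>A\<^esub> u"
  shows "b = b'"
  using hunit_mult_div assms by metis

lemma hunit_left_div:
  assumes g: "g \<in> carrier G" and u: "u \<in> hunits g" and y: "y \<in> gr g"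
  obtains x where "x \<in> gr \<one>\<^bsub>G\<^esub>" "u \<otimes>\<^bsub>A\<^esub> x = y"
proof -
  let ?w = "right_inv A u" and ?s = "\<phi> g (inv\<^bsub>G\<^esub> g) g"
  have w: "?w \<in> gr (inv\<^bsub>G\<^esub> g)" "u \<otimes>\<^bsub>A\<^esub> ?w = \<one>\<^bsub>A\<^esub>"
    using right_inv_props[OF g u] .
  have wy: "?w \<otimes>\<^bsub>A\<^esub> y \<in> gr \<one>\<^bsub>G\<^esub>"
    using gr_mult[OF _ g w(1) y] g by simp
  have c: "u \<in> carrier A" "?w \<otimes>\<^bsub>A\<^esub> y \<in> carrier A" "?s \<in> carrier K"
    using u gr_carrier[OF g] gr_carrier[OF G.one_closed wy] g phi_closed by auto
  \<comment> \<open>Since \<open>u\<close> times \<open>?w\<close> is 1, the left side is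
    \<open>y\<close>. The scalar can be moved inside the product, so the solution x is
    \<open>?s\<close> times the product of \<open>?w\<close> and \<open>y\<close>.\<close>
  have "(u \<otimes>\<^bsub>A\<^esub> ?w) \<otimes>\<^bsub>A\<^esub> y = ?s \<odot>\<^bsub>A\<^esub> (u \<otimes>\<^bsub>A\<^esub> (?w \<otimes>\<^bsub>A\<^esub> y))"
    using quasi_assoc[of g "inv\<^bsub>G\<^esub> g" g u ?w y] g u y w(1) by blast
  then have "u \<otimes>\<^bsub>A\<^esub> (?s \<odot>\<^bsub>A\<^esub> (?w \<otimes>\<^bsub>A\<^esub> y)) = (u \<otimes>\<^bsub>A\<^esub> ?w) \<otimes>\<^bsub>A\<^esub> y"
    using smult_mult_r[OF c(3,1,2)] by simp
  then have "u \<otimes>\<^bsub>A\<^esub> (?s \<odot>\<^bsub>A\<^esub> (?w \<otimes>\<^bsub>A\<^esub> y)) = y"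
    using w(2) unit_l gr_carrier[OF g y] by simp
  then show thesis
    by (rule that[OF gr_smult[OF G.one_closed c(3) wy]])
qed

text \<open>Inverses up to invertible scalars can be rescaled to inverses. Rebracketing a product of
  units yields inverses only in this weaker form.\<close>

lemma hunitI:
  assumes x: "x \<in> gr g" and g: "g \<in> carrier G" and st: "s \<in> Units K" "t \<in> Units K"
    and y: "y \<in> carrier A" "y \<otimes>\<^bsub>A\<^esub> x = s \<odot>\<^bsub>A\<^esub> \<one>\<^bsub>A\<^esub>"
    and z: "z \<in> carrier A" "x \<otimes>\<^bsub>A\<^esub> z = t \<odot>\<^bsub>A\<^esub> \<one>\<^bsub>A\<^esub>"
  shows "x \<in> hunits g"
proof -
  have xc: "x \<in> carrier A" using gr_carrier g x by blast
  have i: "inv\<^bsub>K\<^esub> s \<in> carrier K" "inv\<^bsub>K\<^esub> t \<in> carrier K" "s \<in> carrier K" "t \<in> carrier K"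
    using st K.Units_closed K.Units_inv_closed by blast+
  have "(inv\<^bsub>K\<^esub> s \<odot>\<^bsub>A\<^esub> y) \<otimes>\<^bsub>A\<^esub> x = (inv\<^bsub>K\<^esub> s \<otimes>\<^bsub>K\<^esub> s) \<odot>\<^bsub>A\<^esub> \<one>\<^bsub>A\<^esub>"
    using i y xc by (simp add: smult_mult_l smult_assoc1 unit_closed)
  moreover have "x \<otimes>\<^bsub>A\<^esub> (inv\<^bsub>K\<^esub> t \<odot>\<^bsub>A\<^esub> z) = (inv\<^bsub>K\<^esub> t \<otimes>\<^bsub>K\<^esub> t) \<odot>\<^bsub>A\<^esub> \<one>\<^bsub>A\<^esub>"
    using i z xc by (simp add: smult_mult_r smult_assoc1 unit_closed)
  ultimately have "(inv\<^bsub>K\<^esub> s \<odot>\<^bsub>A\<^esub> y) \<otimes>\<^bsub>A\<^esub> x = \<one>\<^bsub>A\<^esub>" "x \<otimes>\<^bsub>A\<^esub> (inv\<^bsub>K\<^esub> t \<odot>\<^bsub>A\<^esub> z) = \<one>\<^bsub>A\<^esub>"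
    using st unit_closed by simp_all
  then have "x \<in> lr_units A"
    unfolding lr_units_def using xc smult_closed i y(1) z(1) by blast
  then show ?thesis using x by simp
qed

text \<open>The candidates are the products of the inverses in reverse order. Left and right
  inverses may differ, so each side is computed from its own pair, with its own cocycle
  values.\<close>

lemma hunits_mult:
  assumes g: "g \<in> carrier G" and h: "h \<in> carrier G" and u: "u \<in> hunits g" and v: "v \<in> hunits h"
  shows "u \<otimes>\<^bsub>A\<^esub> v \<in> hunits (g \<otimes>\<^bsub>G\<^esub> h)"
proof -
  obtain u' where u': "u' \<in> gr (inv\<^bsub>G\<^esub> g)" "u' \<otimes>\<^bsub>A\<^esub> u = \<one>\<^bsub>A\<^esub>" using hunit_left_inv[OF g u] .
  obtain v' where v': "v' \<in> gr (inv\<^bsub>G\<^esub> h)" "v' \<otimes>\<^bsub>A\<^esub> v = \<one>\<^bsub>A\<^esub>" using hunit_left_inv[OF h v] .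
  obtain u'' where u'': "u'' \<in> gr (inv\<^bsub>G\<^esub> g)" "u \<otimes>\<^bsub>A\<^esub> u'' = \<one>\<^bsub>A\<^esub>" using hunit_right_inv[OF g u] .
  obtain v'' where v'': "v'' \<in> gr (inv\<^bsub>G\<^esub> h)" "v \<otimes>\<^bsub>A\<^esub> v'' = \<one>\<^bsub>A\<^esub>" using hunit_right_inv[OF h v] .
  have gh: "inv\<^bsub>G\<^esub> g \<in> carrier G" "inv\<^bsub>G\<^esub> h \<in> carrier G" "g \<otimes>\<^bsub>G\<^esub> h \<in> carrier G" using g h by auto
  have c: "u \<in> carrier A" "v \<in> carrier A" "u' \<in> carrier A" "v' \<in> carrier A" "u'' \<in> carrier A" "v'' \<in> carrier A"
    using u v u' v' u'' v'' gr_carrier g h gh by blast+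
  have uv: "u \<otimes>\<^bsub>A\<^esub> v \<in> gr (g \<otimes>\<^bsub>G\<^esub> h)" using gr_mult u v g h by auto
  \<comment> \<open>\<open>?p\<close> comes from rebracketing (u' u) v and \<open>?q\<close> from
    (v' u') (u v); \<open>?r\<close> comes from (v v'') u'' and \<open>?s\<close> from (u v) (v''
    u''). The two products are then \<open>?q\<close> / \<open>?p\<close> and \<open>?s\<close> /
    \<open>?r\<close> times 1.\<close>
  let ?p = "\<phi> (inv\<^bsub>G\<^esub> g) g h" and ?q = "\<phi> (inv\<^bsub>G\<^esub> h) (inv\<^bsub>G\<^esub> g) (g \<otimes>\<^bsub>G\<^esub> h)"
  let ?r = "\<phi> h (inv\<^bsub>G\<^esub> h) (inv\<^bsub>G\<^esub> g)" and ?s = "\<phi> g h (inv\<^bsub>G\<^esub> h \<otimes>\<^bsub>G\<^esub> inv\<^bsub>G\<^esub> g)"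
  have U: "?p \<in> Units K" "?q \<in> Units K" "?r \<in> Units K" "?s \<in> Units K"
    using g h gh phi_Units by auto
  then have C: "?p \<in> carrier K" "?q \<in> carrier K" "?r \<in> carrier K" "?s \<in> carrier K"
    "inv\<^bsub>K\<^esub> ?p \<in> carrier K" "inv\<^bsub>K\<^esub> ?r \<in> carrier K"
    using K.Units_closed K.Units_inv_closed by blast+
  have p: "u' \<otimes>\<^bsub>A\<^esub> (u \<otimes>\<^bsub>A\<^esub> v) = inv\<^bsub>K\<^esub> ?p \<odot>\<^bsub>A\<^esub> v"
  proof (rule smult_Units_cancel[OF U(1)])
    show "?p \<odot>\<^bsub>A\<^esub> (u' \<otimes>\<^bsub>A\<^esub> (u \<otimes>\<^bsub>A\<^esub> v)) = ?p \<odot>\<^bsub>A\<^esub> (inv\<^bsub>K\<^esub> ?p \<odot>\<^bsub>A\<^esub> v)"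
      using quasi_assoc[of "inv\<^bsub>G\<^esub> g" g h u' u v] g h gh u v u' c U C
      by (simp add: unit_l flip: smult_assoc1)
  qed (use c C in \<open>auto intro!: mult_closed\<close>)
  have "(v' \<otimes>\<^bsub>A\<^esub> u') \<otimes>\<^bsub>A\<^esub> (u \<otimes>\<^bsub>A\<^esub> v) = ?q \<odot>\<^bsub>A\<^esub> (v' \<otimes>\<^bsub>A\<^esub> (inv\<^bsub>K\<^esub> ?p \<odot>\<^bsub>A\<^esub> v))"
    using quasi_assoc[of "inv\<^bsub>G\<^esub> h" "inv\<^bsub>G\<^esub> g" "g \<otimes>\<^bsub>G\<^esub> h" v' u' "u \<otimes>\<^bsub>A\<^esub> v"] p gh uv u' v' by simp
  also have "\<dots> = (?q \<otimes>\<^bsub>K\<^esub> inv\<^bsub>K\<^esub> ?p) \<odot>\<^bsub>A\<^esub> \<one>\<^bsub>A\<^esub>"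
    using c C v' by (simp add: smult_mult_r smult_assoc1 unit_closed)
  finally have l: "(v' \<otimes>\<^bsub>A\<^esub> u') \<otimes>\<^bsub>A\<^esub> (u \<otimes>\<^bsub>A\<^esub> v) = (?q \<otimes>\<^bsub>K\<^esub> inv\<^bsub>K\<^esub> ?p) \<odot>\<^bsub>A\<^esub> \<one>\<^bsub>A\<^esub>" .
  have r: "v \<otimes>\<^bsub>A\<^esub> (v'' \<otimes>\<^bsub>A\<^esub> u'') = inv\<^bsub>K\<^esub> ?r \<odot>\<^bsub>A\<^esub> u''"
  proof (rule smult_Units_cancel[OF U(3)])
    show "?r \<odot>\<^bsub>A\<^esub> (v \<otimes>\<^bsub>A\<^esub> (v'' \<otimes>\<^bsub>A\<^esub> u'')) = ?r \<odot>\<^bsub>A\<^esub> (inv\<^bsub>K\<^esub> ?r \<odot>\<^bsub>A\<^esub> u'')"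
      using quasi_assoc[of h "inv\<^bsub>G\<^esub> h" "inv\<^bsub>G\<^esub> g" v v'' u''] g h gh v v'' u'' c U C
      by (simp add: unit_l flip: smult_assoc1)
  qed (use c C in \<open>auto intro!: mult_closed\<close>)
  have "(u \<otimes>\<^bsub>A\<^esub> v) \<otimes>\<^bsub>A\<^esub> (v'' \<otimes>\<^bsub>A\<^esub> u'') = ?s \<odot>\<^bsub>A\<^esub> (u \<otimes>\<^bsub>A\<^esub> (inv\<^bsub>K\<^esub> ?r \<odot>\<^bsub>A\<^esub> u''))"
    using quasi_assoc[of g h "inv\<^bsub>G\<^esub> h \<otimes>\<^bsub>G\<^esub> inv\<^bsub>G\<^esub> g" u v "v'' \<otimes>\<^bsub>A\<^esub> u''"] r g h gh u v
      gr_mult[OF gh(2) gh(1) v''(1) u''(1)] by simp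
  also have "\<dots> = (?s \<otimes>\<^bsub>K\<^esub> inv\<^bsub>K\<^esub> ?r) \<odot>\<^bsub>A\<^esub> \<one>\<^bsub>A\<^esub>"
    using c C u'' by (simp add: smult_mult_r smult_assoc1 unit_closed)
  finally have r: "(u \<otimes>\<^bsub>A\<^esub> v) \<otimes>\<^bsub>A\<^esub> (v'' \<otimes>\<^bsub>A\<^esub> u'') = (?s \<otimes>\<^bsub>K\<^esub> inv\<^bsub>K\<^esub> ?r) \<odot>\<^bsub>A\<^esub> \<one>\<^bsub>A\<^esub>" .
  show ?thesis
    by (rule hunitI[OF uv gh(3) _ _ _ l _ r]) (use U c mult_closed in auto)
qed

lemma one_hunit: "\<one>\<^bsub>A\<^esub> \<in> hunits \<one>\<^bsub>G\<^esub>"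
  using one_gr unit_closed unit_l by (auto simp: lr_units_def)

lemma hunit_neq_zero: "u \<in> hunits g \<Longrightarrow> u \<noteq> \<zero>\<^bsub>A\<^esub>"
  using algebra_one_neq_zero mult_zero_r by (auto simp: lr_units_def)

section \<open>The component of degree e as an associative algebra\<close>

abbreviation N where "N \<equiv> neutral_algebra G A gr"

lemma neutral_simps [simp]:
  "carrier N = gr \<one>\<^bsub>G\<^esub>" "x \<otimes>\<^bsub>N\<^esub> y = x \<otimes>\<^bsub>A\<^esub> y" "x \<oplus>\<^bsub>N\<^esub> y = x \<oplus>\<^bsub>A\<^esub> y"
  "\<one>\<^bsub>N\<^esub> = \<one>\<^bsub>A\<^esub>" "\<zero>\<^bsub>N\<^esub> = \<zero>\<^bsub>A\<^esub>"
  "a \<odot>\<^bsub>N\<^esub> x = a \<odot>\<^bsub>A\<^esub> x"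
  by (simp_all add: neutral_algebra_def)

lemma neutral_assoc_unital_algebra: "assoc_unital_algebra K N"
proof -
  have "module K A" by unfold_locales
  then have "module K N"
    using submodule.submodule_is_module[OF gr_submodule[OF G.one_closed]]
    unfolding neutral_algebra_def by blast
  then interpret N: module K N .
  have c: "x \<in> carrier A" if "x \<in> gr \<one>\<^bsub>G\<^esub>" for x
    using that gr_carrier by blast
  show ?thesis
  proof
    show "carrier N \<noteq> {\<zero>\<^bsub>N\<^esub>}"
      using one_gr algebra_one_neq_zero by auto
  qed (auto simp: c gr_mult_one_l one_gr mult_l_distr mult_r_distr smult_mult_l smult_mult_r
      unit_l unit_r assoc_left[of "\<one>\<^bsub>G\<^esub>" "\<one>\<^bsub>G\<^esub>"])
qed

text \<open>A unit of \<open>A\<close> of degree e has a left and a right inverse of degree e^-1 =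
  e, so it stays a unit inside A_e.\<close>

lemma neutral_lr_units: "lr_units N = hunits \<one>\<^bsub>G\<^esub>"
proof
  show "lr_units N \<subseteq> hunits \<one>\<^bsub>G\<^esub>"
    using gr_carrier[OF G.one_closed] by (auto simp: lr_units_def)
  show "hunits \<one>\<^bsub>G\<^esub> \<subseteq> lr_units N"
  proof
    fix u assume u: "u \<in> hunits \<one>\<^bsub>G\<^esub>"
    obtain v where "v \<in> gr (inv\<^bsub>G\<^esub> \<one>\<^bsub>G\<^esub>)" "v \<otimes>\<^bsub>A\<^esub> u = \<one>\<^bsub>A\<^esub>"
      using hunit_left_inv[OF G.one_closed u] .
    moreover obtain w where "w \<in> gr (inv\<^bsub>G\<^esub> \<one>\<^bsub>G\<^esub>)" "u \<otimes>\<^bsub>A\<^esub> w = \<one>\<^bsub>A\<^esub>"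
      using hunit_right_inv[OF G.one_closed u] .
    ultimately show "u \<in> lr_units N"
      using u by (auto simp: lr_units_def)
  qed
qed

end

lemma (in assoc_unital_algebra) assoc_unital_algebra_monoid: "monoid A"
  by unfold_locales (auto simp: mult_closed unit_closed unit_l unit_r mult_assoc)

lemma (in assoc_unital_algebra) lr_units_inv:
  assumes "u \<in> lr_units A"
  shows "inv\<^bsub>A\<^esub> u \<in> carrier A" "u \<otimes>\<^bsub>A\<^esub> inv\<^bsub>A\<^esub> u = \<one>\<^bsub>A\<^esub>" "inv\<^bsub>A\<^esub> u \<otimes>\<^bsub>A\<^esub> u = \<one>\<^bsub>A\<^esub>"
  using assms monoid.Units_inv_closed monoid.Units_r_inv monoid.Units_l_inv
    assoc_unital_algebra_monoid lr_units_eq_Units by metis+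

section \<open>The system of a choice of units\<close>

context graded_quasialgebra
begin

text \<open>Here \<open>s\<close> and \<open>t\<close> stand for \<sigma>(g)(b') and \<alpha>(g,h),
  known only through the relations \<open>su\<close> and \<open>tw\<close>. Each rebracketing
  involves a factor of degree e, hence no value of \<phi> appears. The same computation serves for
  rescaled units and for the product formula in both algebras.\<close>

lemma hunit_product:
  assumes g: "g \<in> carrier G" and h: "h \<in> carrier G"
    and u: "u \<in> gr g" and v: "v \<in> gr h" and w: "w \<in> gr (g \<otimes>\<^bsub>G\<^esub> h)"
    and b: "b \<in> gr \<one>\<^bsub>G\<^esub>" "b' \<in> gr \<one>\<^bsub>G\<^esub>" and st: "s \<in> gr \<one>\<^bsub>G\<^esub>" "t \<in> gr \<one>\<^bsub>G\<^esub>"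
    and su: "s \<otimes>\<^bsub>A\<^esub> u = u \<otimes>\<^bsub>A\<^esub> b'" and tw: "t \<otimes>\<^bsub>A\<^esub> w = u \<otimes>\<^bsub>A\<^esub> v"
  shows "(b \<otimes>\<^bsub>A\<^esub> u) \<otimes>\<^bsub>A\<^esub> (b' \<otimes>\<^bsub>A\<^esub> v) = ((b \<otimes>\<^bsub>A\<^esub> s) \<otimes>\<^bsub>A\<^esub> t) \<otimes>\<^bsub>A\<^esub> w"
proof -
  have gh: "g \<otimes>\<^bsub>G\<^esub> h \<in> carrier G" using g h by simp
  have e: "\<one>\<^bsub>G\<^esub> \<in> carrier G" by simp
  have "(b \<otimes>\<^bsub>A\<^esub> u) \<otimes>\<^bsub>A\<^esub> (b' \<otimes>\<^bsub>A\<^esub> v) = b \<otimes>\<^bsub>A\<^esub> (u \<otimes>\<^bsub>A\<^esub> (b' \<otimes>\<^bsub>A\<^esub> v))"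
    by (rule assoc_left[OF g h b(1) u gr_mult_one_l[OF h b(2) v]])
  also have "u \<otimes>\<^bsub>A\<^esub> (b' \<otimes>\<^bsub>A\<^esub> v) = (u \<otimes>\<^bsub>A\<^esub> b') \<otimes>\<^bsub>A\<^esub> v"
    by (rule assoc_mid[OF g h u b(2) v, symmetric])
  also have "\<dots> = s \<otimes>\<^bsub>A\<^esub> (u \<otimes>\<^bsub>A\<^esub> v)"
    unfolding su[symmetric] by (rule assoc_left[OF g h st(1) u v])
  also have "b \<otimes>\<^bsub>A\<^esub> (s \<otimes>\<^bsub>A\<^esub> (u \<otimes>\<^bsub>A\<^esub> v)) = (b \<otimes>\<^bsub>A\<^esub> s) \<otimes>\<^bsub>A\<^esub> (t \<otimes>\<^bsub>A\<^esub> w)"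
    unfolding tw by (rule assoc_left[OF e gh b(1) st(1) gr_mult[OF g h u v], symmetric])
  also have "\<dots> = ((b \<otimes>\<^bsub>A\<^esub> s) \<otimes>\<^bsub>A\<^esub> t) \<otimes>\<^bsub>A\<^esub> w"
    by (rule assoc_left[OF e gh gr_mult_one_l[OF e b(1) st(1)] st(2) w, symmetric])
  finally show ?thesis .
qed

context
  fixes c
  assumes c: "c \<in> unit_choices G A gr"
begin

abbreviation act where "act \<equiv> qact (system_of_choice G A \<phi> c)"
abbreviation tw where "tw \<equiv> qtwist (system_of_choice G A \<phi> c)"

lemma choice_hunits: "g \<in> carrier G \<Longrightarrow> c g \<in> hunits g"
  using c unfolding unit_choices_def by blast

lemma choice_gr: "g \<in> carrier G \<Longrightarrow> c g \<in> gr g"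
  using choice_hunits by blast

lemma choice_one: "c \<one>\<^bsub>G\<^esub> = \<one>\<^bsub>A\<^esub>"
  using c unfolding unit_choices_def by blast

lemma
  assumes g: "g \<in> carrier G" and x: "x \<in> gr \<one>\<^bsub>G\<^esub>"
  shows act_gr: "act g x \<in> gr \<one>\<^bsub>G\<^esub>"
    and act_mult: "act g x \<otimes>\<^bsub>A\<^esub> c g = c g \<otimes>\<^bsub>A\<^esub> x"
  using hunit_div[OF g choice_hunits[OF g] gr_mult_one_r[OF g choice_gr[OF g] x]]
  by (simp_all add: system_of_choice_def)

lemma act_eqI:
  assumes g: "g \<in> carrier G" and b: "b \<in> gr \<one>\<^bsub>G\<^esub>" and eq: "b \<otimes>\<^bsub>A\<^esub> c g = c g \<otimes>\<^bsub>A\<^esub> x"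
  shows "act g x = b"
  using hunit_mult_div[OF g choice_hunits[OF g] b] eq by (simp add: system_of_choice_def)

lemma
  assumes g: "g \<in> carrier G" and h: "h \<in> carrier G"
  shows twist_gr: "tw g h \<in> gr \<one>\<^bsub>G\<^esub>"
    and twist_mult: "tw g h \<otimes>\<^bsub>A\<^esub> c (g \<otimes>\<^bsub>G\<^esub> h) = c g \<otimes>\<^bsub>A\<^esub> c h"
  using hunit_div[OF G.m_closed[OF g h] choice_hunits[OF G.m_closed[OF g h]]
      gr_mult[OF g h choice_gr[OF g] choice_gr[OF h]]]
  by (simp_all add: system_of_choice_def)

lemma twist_eqI:
  assumes g: "g \<in> carrier G" and h: "h \<in> carrier G" and b: "b \<in> gr \<one>\<^bsub>G\<^esub>"
    and eq: "b \<otimes>\<^bsub>A\<^esub> c (g \<otimes>\<^bsub>G\<^esub> h) = c g \<otimes>\<^bsub>A\<^esub> c h"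
  shows "tw g h = b"
  using hunit_mult_div[OF G.m_closed[OF g h] choice_hunits[OF G.m_closed[OF g h]] b] eq
  by (simp add: system_of_choice_def)

text \<open>Both \<open>c (g \<otimes> h)\<close> and the product of \<open>c g\<close> and
  \<open>c h\<close> are units of degree gh. Dividing each by the other gives two elements of A_e
  that are inverse to each other.\<close>

lemma twist_unit:
  assumes g: "g \<in> carrier G" and h: "h \<in> carrier G"
  shows "tw g h \<in> lr_units N"
proof -
  have gh: "g \<otimes>\<^bsub>G\<^esub> h \<in> carrier G" using g h by simp
  let ?u = "c (g \<otimes>\<^bsub>G\<^esub> h)" and ?v = "c g \<otimes>\<^bsub>A\<^esub> c h"
  have u: "?u \<in> hunits (g \<otimes>\<^bsub>G\<^esub> h)" and v: "?v \<in> hunits (g \<otimes>\<^bsub>G\<^esub> h)"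
    using choice_hunits[OF gh] hunits_mult[OF g h choice_hunits[OF g] choice_hunits[OF h]] by auto
  let ?b = "?u \<otimes>\<^bsub>A\<^esub> right_inv A ?v"
  have b: "?b \<in> gr \<one>\<^bsub>G\<^esub>" "?b \<otimes>\<^bsub>A\<^esub> ?v = ?u"
    using hunit_div[OF gh v] u by auto
  note t = twist_gr[OF g h] twist_mult[OF g h]
  have "(tw g h \<otimes>\<^bsub>A\<^esub> ?b) \<otimes>\<^bsub>A\<^esub> ?v = \<one>\<^bsub>A\<^esub> \<otimes>\<^bsub>A\<^esub> ?v"
    using assoc_left[OF G.one_closed gh t(1) b(1), of ?v] v b t unit_l[of ?v] gr_carrier[OF gh] by simp
  then have "tw g h \<otimes>\<^bsub>A\<^esub> ?b = \<one>\<^bsub>A\<^esub>"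
    by (rule hunit_cancel_r[OF gh v gr_mult_one_l[OF G.one_closed t(1) b(1)] one_gr])
  moreover have "(?b \<otimes>\<^bsub>A\<^esub> tw g h) \<otimes>\<^bsub>A\<^esub> ?u = \<one>\<^bsub>A\<^esub> \<otimes>\<^bsub>A\<^esub> ?u"
    using assoc_left[OF G.one_closed gh b(1) t(1), of ?u] u b t unit_l[of ?u] gr_carrier[OF gh] by simp
  then have "?b \<otimes>\<^bsub>A\<^esub> tw g h = \<one>\<^bsub>A\<^esub>"
    by (rule hunit_cancel_r[OF gh u gr_mult_one_l[OF G.one_closed b(1) t(1)] one_gr])
  ultimately show ?thesis
    using t(1) b(1) by (auto simp: lr_units_def)
qed

text \<open>Compatibility with the operations is checked after multiplication by \<open>c g\<close>,
  which turns \<open>act g x\<close> into the product of \<open>c g\<close> and \<open>x\<close>.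
  Injectivity is left cancellation of \<open>c g\<close>, and a preimage of y is a solution x of
  c(g) x = y c(g).\<close>

lemma act_aut:
  assumes g: "g \<in> carrier G"
  shows "act g \<in> algebra_aut K N"
proof -
  note e = G.one_closed and cg = choice_gr[OF g]
  have c': "x \<in> carrier A" if "x \<in> gr \<one>\<^bsub>G\<^esub>" for x
    using that gr_carrier by blast
  have cc: "c g \<in> carrier A" using cg g gr_carrier by blast
  note ac = act_gr[OF g] and am = act_mult[OF g]
  have mult: "act g (x \<otimes>\<^bsub>A\<^esub> y) = act g x \<otimes>\<^bsub>A\<^esub> act g y" if x: "x \<in> gr \<one>\<^bsub>G\<^esub>" and y: "y \<in> gr \<one>\<^bsub>G\<^esub>" for x y
  proof (rule act_eqI[OF g gr_mult_one_l[OF e ac[OF x] ac[OF y]]])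
    have "(act g x \<otimes>\<^bsub>A\<^esub> act g y) \<otimes>\<^bsub>A\<^esub> c g = act g x \<otimes>\<^bsub>A\<^esub> (c g \<otimes>\<^bsub>A\<^esub> y)"
      unfolding am[OF y, symmetric] by (rule assoc_left[OF e g ac[OF x] ac[OF y] cg])
    also have "\<dots> = (c g \<otimes>\<^bsub>A\<^esub> x) \<otimes>\<^bsub>A\<^esub> y"
      unfolding am[OF x, symmetric] by (rule assoc_left[OF g e ac[OF x] cg y, symmetric])
    also have "\<dots> = c g \<otimes>\<^bsub>A\<^esub> (x \<otimes>\<^bsub>A\<^esub> y)"
      by (rule assoc_mid[OF g e cg x y])
    finally show "(act g x \<otimes>\<^bsub>A\<^esub> act g y) \<otimes>\<^bsub>A\<^esub> c g = c g \<otimes>\<^bsub>A\<^esub> (x \<otimes>\<^bsub>A\<^esub> y)" .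
  qed
  have add: "act g (x \<oplus>\<^bsub>A\<^esub> y) = act g x \<oplus>\<^bsub>A\<^esub> act g y" if x: "x \<in> gr \<one>\<^bsub>G\<^esub>" and y: "y \<in> gr \<one>\<^bsub>G\<^esub>" for x y
    using x y by (intro act_eqI[OF g gr_add[OF e ac[OF x] ac[OF y]]])
      (simp add: mult_l_distr mult_r_distr c' cc ac am)
  have smult: "act g (a \<odot>\<^bsub>A\<^esub> x) = a \<odot>\<^bsub>A\<^esub> act g x" if a: "a \<in> carrier K" and x: "x \<in> gr \<one>\<^bsub>G\<^esub>" for a x
    using a x by (intro act_eqI[OF g gr_smult[OF e a ac[OF x]]])
      (simp add: smult_mult_l smult_mult_r c' cc ac am)
  have one: "act g \<one>\<^bsub>A\<^esub> = \<one>\<^bsub>A\<^esub>"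
    by (rule act_eqI[OF g one_gr]) (simp add: cc unit_l unit_r)
  have inj: "inj_on (act g) (gr \<one>\<^bsub>G\<^esub>)"
  proof (rule inj_onI)
    fix x y assume x: "x \<in> gr \<one>\<^bsub>G\<^esub>" and y: "y \<in> gr \<one>\<^bsub>G\<^esub>" and "act g x = act g y"
    then have "c g \<otimes>\<^bsub>A\<^esub> x = c g \<otimes>\<^bsub>A\<^esub> y"
      using am[OF x] am[OF y] by simp
    then show "x = y"
      by (rule hunit_cancel[OF g choice_hunits[OF g] e x y])
  qed
  have surj: "act g ` gr \<one>\<^bsub>G\<^esub> = gr \<one>\<^bsub>G\<^esub>"
  proof
    show "gr \<one>\<^bsub>G\<^esub> \<subseteq> act g ` gr \<one>\<^bsub>G\<^esub>"
    proof
      fix y assume y: "y \<in> gr \<one>\<^bsub>G\<^esub>"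
      obtain x where "x \<in> gr \<one>\<^bsub>G\<^esub>" "c g \<otimes>\<^bsub>A\<^esub> x = y \<otimes>\<^bsub>A\<^esub> c g"
        using hunit_left_div[OF g choice_hunits[OF g] gr_mult_one_l[OF g y cg]] .
      then show "y \<in> act g ` gr \<one>\<^bsub>G\<^esub>"
        using act_eqI[OF g y, of x] by force
    qed
  qed (use ac in blast)
  show ?thesis
    unfolding algebra_iso_def ring_iso_def bij_betw_def
    using mult add smult one inj surj ac by (auto intro!: ring_hom_memI)
qed

text \<open>Multiplied by \<open>c (g \<otimes> h)\<close>, both sides become (c(g) c(h)) x. Since
  \<open>x\<close> and the values of \<open>act\<close> have degree e, no cocycle value
  enters.\<close>

lemma act_act:
  assumes g: "g \<in> carrier G" and h: "h \<in> carrier G" and x: "x \<in> gr \<one>\<^bsub>G\<^esub>"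
  shows "act g (act h x) \<otimes>\<^bsub>A\<^esub> tw g h = tw g h \<otimes>\<^bsub>A\<^esub> act (g \<otimes>\<^bsub>G\<^esub> h) x"
proof -
  have gh: "g \<otimes>\<^bsub>G\<^esub> h \<in> carrier G" using g h by simp
  note e = G.one_closed and t = twist_gr[OF g h]
  let ?a = "act g (act h x)" and ?w = "c (g \<otimes>\<^bsub>G\<^esub> h)"
  have hx: "act h x \<in> gr \<one>\<^bsub>G\<^esub>" and a: "?a \<in> gr \<one>\<^bsub>G\<^esub>" and ghx: "act (g \<otimes>\<^bsub>G\<^esub> h) x \<in> gr \<one>\<^bsub>G\<^esub>"
    using act_gr g h gh x by auto
  note cs = choice_gr[OF g] choice_gr[OF h] choice_gr[OF gh]
  have "(?a \<otimes>\<^bsub>A\<^esub> tw g h) \<otimes>\<^bsub>A\<^esub> ?w = ?a \<otimes>\<^bsub>A\<^esub> (c g \<otimes>\<^bsub>A\<^esub> c h)"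
    unfolding twist_mult[OF g h, symmetric] by (rule assoc_left[OF e gh a t cs(3)])
  also have "\<dots> = (c g \<otimes>\<^bsub>A\<^esub> act h x) \<otimes>\<^bsub>A\<^esub> c h"
    unfolding act_mult[OF g hx, symmetric] by (rule assoc_left[OF g h a cs(1,2), symmetric])
  also have "\<dots> = c g \<otimes>\<^bsub>A\<^esub> (c h \<otimes>\<^bsub>A\<^esub> x)"
    unfolding act_mult[OF h x, symmetric] by (rule assoc_mid[OF g h cs(1) hx cs(2)])
  also have "\<dots> = (tw g h \<otimes>\<^bsub>A\<^esub> ?w) \<otimes>\<^bsub>A\<^esub> x"
    unfolding twist_mult[OF g h] by (rule assoc_right[OF g h cs(1,2) x, symmetric])
  also have "\<dots> = tw g h \<otimes>\<^bsub>A\<^esub> (act (g \<otimes>\<^bsub>G\<^esub> h) x \<otimes>\<^bsub>A\<^esub> ?w)"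
    unfolding act_mult[OF gh x] by (rule assoc_left[OF gh e t cs(3) x])
  also have "\<dots> = (tw g h \<otimes>\<^bsub>A\<^esub> act (g \<otimes>\<^bsub>G\<^esub> h) x) \<otimes>\<^bsub>A\<^esub> ?w"
    by (rule assoc_left[OF e gh t ghx cs(3), symmetric])
  finally show ?thesis
    by (rule hunit_cancel_r[OF gh choice_hunits[OF gh] gr_mult_one_l[OF e a t] gr_mult_one_l[OF e t ghx]])
qed

text \<open>Both sides, multiplied by c(ghk), are the product (c(g) c(h)) c(k) expanded with respect
  to the two bracketings.\<close>

lemma twist_twist:
  assumes g: "g \<in> carrier G" and h: "h \<in> carrier G" and k: "k \<in> carrier G"
  shows "tw g h \<otimes>\<^bsub>A\<^esub> tw (g \<otimes>\<^bsub>G\<^esub> h) k = \<phi> g h k \<odot>\<^bsub>A\<^esub> (act g (tw h k) \<otimes>\<^bsub>A\<^esub> tw g (h \<otimes>\<^bsub>G\<^esub> k))"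
proof -
  have gh: "g \<otimes>\<^bsub>G\<^esub> h \<in> carrier G" and hk: "h \<otimes>\<^bsub>G\<^esub> k \<in> carrier G"
    and ghk: "g \<otimes>\<^bsub>G\<^esub> (h \<otimes>\<^bsub>G\<^esub> k) \<in> carrier G" using g h k by auto
  have eq: "(g \<otimes>\<^bsub>G\<^esub> h) \<otimes>\<^bsub>G\<^esub> k = g \<otimes>\<^bsub>G\<^esub> (h \<otimes>\<^bsub>G\<^esub> k)" using g h k by (rule G.m_assoc)
  note e = G.one_closed
  note t = twist_gr[OF g h] twist_gr[OF h k] twist_gr[OF gh k] twist_gr[OF g hk]
  note cs = choice_gr[OF g] choice_gr[OF h] choice_gr[OF k] choice_gr[OF gh] choice_gr[OF hk] choice_gr[OF ghk]
  let ?w = "c (g \<otimes>\<^bsub>G\<^esub> (h \<otimes>\<^bsub>G\<^esub> k))" and ?s = "act g (tw h k)"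
  have s: "?s \<in> gr \<one>\<^bsub>G\<^esub>" by (rule act_gr[OF g t(2)])
  have p: "\<phi> g h k \<in> carrier K" using phi_closed g h k by simp
  have st: "?s \<otimes>\<^bsub>A\<^esub> tw g (h \<otimes>\<^bsub>G\<^esub> k) \<in> gr \<one>\<^bsub>G\<^esub>" by (rule gr_mult_one_l[OF e s t(4)])
  have "(tw g h \<otimes>\<^bsub>A\<^esub> tw (g \<otimes>\<^bsub>G\<^esub> h) k) \<otimes>\<^bsub>A\<^esub> ?w = tw g h \<otimes>\<^bsub>A\<^esub> (c (g \<otimes>\<^bsub>G\<^esub> h) \<otimes>\<^bsub>A\<^esub> c k)"
    unfolding twist_mult[OF gh k, symmetric] eq by (rule assoc_left[OF e ghk t(1,3) cs(6)])
  also have "\<dots> = (c g \<otimes>\<^bsub>A\<^esub> c h) \<otimes>\<^bsub>A\<^esub> c k"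
    unfolding twist_mult[OF g h, symmetric] by (rule assoc_left[OF gh k t(1) cs(4,3), symmetric])
  \<comment> \<open>The one rebracketing in which none of the three factors is taken from A_e; it is
    the source of \<phi>.\<close>
  also have "\<dots> = \<phi> g h k \<odot>\<^bsub>A\<^esub> (c g \<otimes>\<^bsub>A\<^esub> (tw h k \<otimes>\<^bsub>A\<^esub> c (h \<otimes>\<^bsub>G\<^esub> k)))"
    unfolding twist_mult[OF h k] by (rule quasi_assoc[OF g h k cs(1,2,3)])
  also have "c g \<otimes>\<^bsub>A\<^esub> (tw h k \<otimes>\<^bsub>A\<^esub> c (h \<otimes>\<^bsub>G\<^esub> k)) = (?s \<otimes>\<^bsub>A\<^esub> c g) \<otimes>\<^bsub>A\<^esub> c (h \<otimes>\<^bsub>G\<^esub> k)"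
    unfolding act_mult[OF g t(2)] by (rule assoc_mid[OF g hk cs(1) t(2) cs(5), symmetric])
  also have "\<dots> = ?s \<otimes>\<^bsub>A\<^esub> (tw g (h \<otimes>\<^bsub>G\<^esub> k) \<otimes>\<^bsub>A\<^esub> ?w)"
    unfolding twist_mult[OF g hk] by (rule assoc_left[OF g hk s cs(1,5)])
  also have "\<dots> = (?s \<otimes>\<^bsub>A\<^esub> tw g (h \<otimes>\<^bsub>G\<^esub> k)) \<otimes>\<^bsub>A\<^esub> ?w"
    by (rule assoc_left[OF e ghk s t(4) cs(6), symmetric])
  also have "\<phi> g h k \<odot>\<^bsub>A\<^esub> \<dots> = (\<phi> g h k \<odot>\<^bsub>A\<^esub> (?s \<otimes>\<^bsub>A\<^esub> tw g (h \<otimes>\<^bsub>G\<^esub> k))) \<otimes>\<^bsub>A\<^esub> ?w"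
    by (rule smult_mult_l[OF p gr_carrier[OF e st] gr_carrier[OF ghk cs(6)], symmetric])
  finally show ?thesis
    by (rule hunit_cancel_r[OF ghk choice_hunits[OF ghk] gr_mult_one_l[OF e t(1,3)] gr_smult[OF e p st]])
qed

lemma system_of_choice_mem: "system_of_choice G A \<phi> c \<in> quasicrossed_systems K G N"
proof -
  interpret N: assoc_unital_algebra K N by (rule neutral_assoc_unital_algebra)
  have act: "act g (act h x) = tw g h \<otimes>\<^bsub>N\<^esub> act (g \<otimes>\<^bsub>G\<^esub> h) x \<otimes>\<^bsub>N\<^esub> inv\<^bsub>N\<^esub> (tw g h)"
    if g: "g \<in> carrier G" and h: "h \<in> carrier G" and x: "x \<in> carrier N" for g h x
  proof -
    note i = N.lr_units_inv[OF twist_unit[OF g h]]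
    have a: "act g (act h x) \<in> carrier N" "tw g h \<in> carrier N"
      using act_gr twist_gr g h x by auto
    \<comment> \<open>\<open>act_act\<close> is the required relation multiplied on the right by
      \<alpha>(g,h); the inverse in A_e restores the conjugation.\<close>
    have "act g (act h x) = (act g (act h x) \<otimes>\<^bsub>N\<^esub> tw g h) \<otimes>\<^bsub>N\<^esub> inv\<^bsub>N\<^esub> (tw g h)"
      unfolding N.mult_assoc[OF a i(1)] i(2) by (rule N.unit_r[OF a(1), symmetric])
    then show ?thesis using act_act[OF g h] x by simp
  qed
  have one: "tw g \<one>\<^bsub>G\<^esub> = \<one>\<^bsub>A\<^esub> \<and> tw \<one>\<^bsub>G\<^esub> g = \<one>\<^bsub>A\<^esub>" if g: "g \<in> carrier G" for g
    using g gr_carrier[OF g choice_gr[OF g]]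
    by (auto intro!: twist_eqI simp: one_gr choice_one unit_l unit_r)
  have qc: "qcoc (system_of_choice G A \<phi> c) = \<phi>"
    by (simp add: system_of_choice_def)
  show ?thesis
    unfolding quasicrossed_systems_def
    using G.group_axioms neutral_assoc_unital_algebra cocycle act_aut twist_unit act twist_twist one
    by (simp add: qc)
qed

end

end

text \<open>The equivalence relation on systems records precisely the effect of replacing each unit
  \<open>c g\<close> by \<open>u g\<close> times \<open>c g\<close>. Any \<open>u\<close> witnessing
  an equivalence can thus be absorbed into the choice of units.\<close>

lemma (in graded_quasialgebra)
  assumes c: "c \<in> unit_choices G A gr"
    and u: "u \<in> carrier G \<rightarrow> lr_units N" and u1: "u \<one>\<^bsub>G\<^esub> = \<one>\<^bsub>A\<^esub>"
  defines "d \<equiv> \<lambda>g. u g \<otimes>\<^bsub>A\<^esub> c g"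
  shows rescaled_choice: "d \<in> unit_choices G A gr"
    and rescaled_act: "\<And>g x. g \<in> carrier G \<Longrightarrow> x \<in> gr \<one>\<^bsub>G\<^esub> \<Longrightarrow>
      act d g x = u g \<otimes>\<^bsub>A\<^esub> act c g x \<otimes>\<^bsub>A\<^esub> inv\<^bsub>N\<^esub> (u g)"
    and rescaled_tw: "\<And>g h. g \<in> carrier G \<Longrightarrow> h \<in> carrier G \<Longrightarrow>
      tw d g h = u g \<otimes>\<^bsub>A\<^esub> act c g (u h) \<otimes>\<^bsub>A\<^esub> tw c g h \<otimes>\<^bsub>A\<^esub> inv\<^bsub>N\<^esub> (u (g \<otimes>\<^bsub>G\<^esub> h))"
proof -
  interpret N: assoc_unital_algebra K N by (rule neutral_assoc_unital_algebra)
  note e = G.one_closed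
  have uN: "u g \<in> lr_units N" if "g \<in> carrier G" for g using u that by blast
  have ug: "u g \<in> gr \<one>\<^bsub>G\<^esub>" if "g \<in> carrier G" for g
    using uN[OF that] neutral_lr_units by blast
  have ig: "inv\<^bsub>N\<^esub> (u g) \<in> gr \<one>\<^bsub>G\<^esub>" "inv\<^bsub>N\<^esub> (u g) \<otimes>\<^bsub>A\<^esub> u g = \<one>\<^bsub>A\<^esub>" if "g \<in> carrier G" for g
    using N.lr_units_inv[OF uN[OF that]] by auto
  have cg: "c g \<in> gr g" if "g \<in> carrier G" for g using choice_gr[OF c that] .
  \<comment> \<open>Multiplication by \<open>d g\<close> removes a trailing inverse of
    \<open>u g\<close>. Both formulas below then reduce to statements about
    \<open>c\<close>.\<close>
  have cancel: "(b \<otimes>\<^bsub>A\<^esub> inv\<^bsub>N\<^esub> (u g)) \<otimes>\<^bsub>A\<^esub> (u g \<otimes>\<^bsub>A\<^esub> c g) = b \<otimes>\<^bsub>A\<^esub> c g"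
    if g: "g \<in> carrier G" and b: "b \<in> gr \<one>\<^bsub>G\<^esub>" for b g
  proof -
    have "(b \<otimes>\<^bsub>A\<^esub> inv\<^bsub>N\<^esub> (u g)) \<otimes>\<^bsub>A\<^esub> (u g \<otimes>\<^bsub>A\<^esub> c g)
        = ((b \<otimes>\<^bsub>A\<^esub> inv\<^bsub>N\<^esub> (u g)) \<otimes>\<^bsub>A\<^esub> u g) \<otimes>\<^bsub>A\<^esub> c g"
      by (rule assoc_left[OF e g gr_mult_one_l[OF e b ig(1)[OF g]] ug[OF g] cg[OF g], symmetric])
    also have "(b \<otimes>\<^bsub>A\<^esub> inv\<^bsub>N\<^esub> (u g)) \<otimes>\<^bsub>A\<^esub> u g = b"
      unfolding assoc_left[OF e e b ig(1)[OF g] ug[OF g]] ig(2)[OF g]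
      by (rule unit_r[OF gr_carrier[OF e b]])
    finally show ?thesis .
  qed
  show d: "d \<in> unit_choices G A gr"
    using hunits_mult[OF e, of _ "u _" "c _"] choice_hunits[OF c] uN neutral_lr_units u1 choice_one[OF c]
      unit_l[OF unit_closed]
    unfolding unit_choices_def d_def by fastforce
  show "act d g x = u g \<otimes>\<^bsub>A\<^esub> act c g x \<otimes>\<^bsub>A\<^esub> inv\<^bsub>N\<^esub> (u g)"
    if g: "g \<in> carrier G" and x: "x \<in> gr \<one>\<^bsub>G\<^esub>" for g x
  proof (rule act_eqI[OF d g])
    note a = act_gr[OF c g x]
    have ua: "u g \<otimes>\<^bsub>A\<^esub> act c g x \<in> gr \<one>\<^bsub>G\<^esub>"
      by (rule gr_mult_one_l[OF e ug[OF g] a])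
    show "u g \<otimes>\<^bsub>A\<^esub> act c g x \<otimes>\<^bsub>A\<^esub> inv\<^bsub>N\<^esub> (u g) \<in> gr \<one>\<^bsub>G\<^esub>"
      by (rule gr_mult_one_l[OF e ua ig(1)[OF g]])
    have "(u g \<otimes>\<^bsub>A\<^esub> act c g x) \<otimes>\<^bsub>A\<^esub> c g = u g \<otimes>\<^bsub>A\<^esub> (c g \<otimes>\<^bsub>A\<^esub> x)"
      unfolding act_mult[OF c g x, symmetric] by (rule assoc_left[OF e g ug[OF g] a cg[OF g]])
    also have "\<dots> = d g \<otimes>\<^bsub>A\<^esub> x"
      unfolding d_def by (rule assoc_left[OF g e ug[OF g] cg[OF g] x, symmetric])
    finally show "(u g \<otimes>\<^bsub>A\<^esub> act c g x \<otimes>\<^bsub>A\<^esub> inv\<^bsub>N\<^esub> (u g)) \<otimes>\<^bsub>A\<^esub> d g = d g \<otimes>\<^bsub>A\<^esub> x"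
      unfolding d_def cancel[OF g ua] .
  qed
  show "tw d g h = u g \<otimes>\<^bsub>A\<^esub> act c g (u h) \<otimes>\<^bsub>A\<^esub> tw c g h \<otimes>\<^bsub>A\<^esub> inv\<^bsub>N\<^esub> (u (g \<otimes>\<^bsub>G\<^esub> h))"
    if g: "g \<in> carrier G" and h: "h \<in> carrier G" for g h
  proof (rule twist_eqI[OF d g h])
    let ?gh = "g \<otimes>\<^bsub>G\<^esub> h" and ?b = "u g \<otimes>\<^bsub>A\<^esub> act c g (u h) \<otimes>\<^bsub>A\<^esub> tw c g h"
    have gh: "?gh \<in> carrier G" using g h by simp
    note s = act_gr[OF c g ug[OF h]] and t = twist_gr[OF c g h]
    have b: "?b \<in> gr \<one>\<^bsub>G\<^esub>"
      by (rule gr_mult_one_l[OF e gr_mult_one_l[OF e ug[OF g] s] t])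
    show "?b \<otimes>\<^bsub>A\<^esub> inv\<^bsub>N\<^esub> (u ?gh) \<in> gr \<one>\<^bsub>G\<^esub>"
      by (rule gr_mult_one_l[OF e b ig(1)[OF gh]])
    \<comment> \<open>After the cancellation this is \<open>hunit_product\<close> with b =
      \<open>u g\<close> and b' = \<open>u h\<close>: the factor \<sigma>(g)(u(h)) arises from
      moving \<open>u h\<close> to the left past \<open>c g\<close>.\<close>
    show "(?b \<otimes>\<^bsub>A\<^esub> inv\<^bsub>N\<^esub> (u ?gh)) \<otimes>\<^bsub>A\<^esub> d ?gh = d g \<otimes>\<^bsub>A\<^esub> d h"
      unfolding d_def cancel[OF gh b]
      by (rule hunit_product[OF g h cg[OF g] cg[OF h] cg[OF gh] ug[OF g] ug[OF h] s t
            act_mult[OF c g ug[OF h]] twist_mult[OF c g h], symmetric])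
  qed
qed

lemma (in quasicrossed_product) unit_choices_nonempty: "unit_choices G A gr \<noteq> {}"
proof -
  have "(SOME u. u \<in> hunits g) \<in> hunits g" if "g \<in> carrier G" for g
    using homogeneous_unit[OF that] unfolding some_in_eq .
  then have "(\<lambda>g. SOME u. u \<in> hunits g)(\<one>\<^bsub>G\<^esub> := \<one>\<^bsub>A\<^esub>) \<in> unit_choices G A gr"
    using one_hunit by (auto simp: unit_choices_def)
  then show ?thesis by blast
qed

section \<open>Systems over the same algebra\<close>

lemma same_algebra_sym: "same_algebra K A B \<Longrightarrow> same_algebra K B A"
  by (auto simp: same_algebra_def)

lemma same_algebra_lr_units: "same_algebra K A B \<Longrightarrow> lr_units A = lr_units B"
  by (auto simp: same_algebra_def lr_units_def)

text \<open>The description behind \<open>inv\<close> only ranges over the carrier, where the two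
  products agree.\<close>

lemma same_algebra_inv: "same_algebra K A B \<Longrightarrow> x \<in> carrier A \<Longrightarrow> inv\<^bsub>A\<^esub> x = inv\<^bsub>B\<^esub> x"
  unfolding same_algebra_def m_inv_def by (intro arg_cong[where f = The] ext) auto

lemma same_algebra_aut:
  assumes "same_algebra K A B" "f \<in> algebra_aut K A"
  shows "f \<in> algebra_aut K B"
proof -
  have "f x \<in> carrier B" if "x \<in> carrier B" for x
    using assms that by (auto simp: same_algebra_def algebra_iso_def ring_iso_def ring_hom_def)
  then show ?thesis
    using assms by (auto simp: same_algebra_def algebra_iso_def ring_iso_def ring_hom_def)
qed

text \<open>All elements occurring in the axioms of a system lie in the carrier, so there the
  operations of \<open>B\<close> may be exchanged for those of \<open>B'\<close>. Most of the proof
  establishes these memberships.\<close>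

lemma quasicrossed_systems_same_algebra:
  assumes same: "same_algebra K B B'" and B': "assoc_unital_algebra K B'"
    and S: "S \<in> quasicrossed_systems K G B"
  shows "S \<in> quasicrossed_systems K G B'"
proof -
  interpret B': assoc_unital_algebra K B' by (rule B')
  have "group G" using S by (simp add: quasicrossed_systems_def)
  then interpret G: group G .
  have eq: "x \<otimes>\<^bsub>B\<^esub> y = x \<otimes>\<^bsub>B'\<^esub> y" if "x \<in> carrier B'" "y \<in> carrier B'" for x y
    using same that by (simp add: same_algebra_def)
  have eqs: "a \<odot>\<^bsub>B\<^esub> x = a \<odot>\<^bsub>B'\<^esub> x" if "a \<in> carrier K" "x \<in> carrier B'" for a x
    using same that by (simp add: same_algebra_def)
  have carr: "carrier B = carrier B'" "\<one>\<^bsub>B\<^esub> = \<one>\<^bsub>B'\<^esub>"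
    using same by (simp_all add: same_algebra_def)
  have aut: "qact S g \<in> algebra_aut K B'" if "g \<in> carrier G" for g
    using S that by (auto simp: quasicrossed_systems_def intro!: same_algebra_aut[OF same])
  have ac: "qact S g x \<in> carrier B'" if "g \<in> carrier G" "x \<in> carrier B'" for g x
    using aut[OF that(1)] that(2) by (auto simp: algebra_iso_def ring_iso_def ring_hom_def)
  have tu: "qtwist S g h \<in> lr_units B'" if "g \<in> carrier G" "h \<in> carrier G" for g h
    using S that by (auto simp: quasicrossed_systems_def same_algebra_lr_units[OF same])
  have tc: "qtwist S g h \<in> carrier B'" if "g \<in> carrier G" "h \<in> carrier G" for g h
    using tu[OF that] by (simp add: lr_units_def)
  have ti: "inv\<^bsub>B\<^esub> (qtwist S g h) = inv\<^bsub>B'\<^esub> (qtwist S g h)" "inv\<^bsub>B'\<^esub> (qtwist S g h) \<in> carrier B'"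
    if "g \<in> carrier G" "h \<in> carrier G" for g h
    using same_algebra_inv[OF same] tc[OF that] carr B'.lr_units_inv(1)[OF tu[OF that]] by simp_all
  have coc: "cocycle K G (qcoc S)" using S by (simp add: quasicrossed_systems_def)
  then have pc: "qcoc S g h k \<in> carrier K" if "g \<in> carrier G" "h \<in> carrier G" "k \<in> carrier G" for g h k
    using that B'.K.Units_closed unfolding cocycle_def by blast
  have "qact S g (qact S h x)
      = qtwist S g h \<otimes>\<^bsub>B'\<^esub> qact S (g \<otimes>\<^bsub>G\<^esub> h) x \<otimes>\<^bsub>B'\<^esub> inv\<^bsub>B'\<^esub> (qtwist S g h)"
    if "g \<in> carrier G" "h \<in> carrier G" "x \<in> carrier B'" for g h x
  proof -
    have "qact S g (qact S h x)
        = qtwist S g h \<otimes>\<^bsub>B\<^esub> qact S (g \<otimes>\<^bsub>G\<^esub> h) x \<otimes>\<^bsub>B\<^esub> inv\<^bsub>B\<^esub> (qtwist S g h)"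
      using S that carr unfolding quasicrossed_systems_def by blast
    then show ?thesis
      using that by (simp add: eq ac tc ti B'.mult_closed)
  qed
  moreover have "qtwist S g h \<otimes>\<^bsub>B'\<^esub> qtwist S (g \<otimes>\<^bsub>G\<^esub> h) k
      = qcoc S g h k \<odot>\<^bsub>B'\<^esub> (qact S g (qtwist S h k) \<otimes>\<^bsub>B'\<^esub> qtwist S g (h \<otimes>\<^bsub>G\<^esub> k))"
    if "g \<in> carrier G" "h \<in> carrier G" "k \<in> carrier G" for g h k
  proof -
    have "qtwist S g h \<otimes>\<^bsub>B\<^esub> qtwist S (g \<otimes>\<^bsub>G\<^esub> h) k
        = qcoc S g h k \<odot>\<^bsub>B\<^esub> (qact S g (qtwist S h k) \<otimes>\<^bsub>B\<^esub> qtwist S g (h \<otimes>\<^bsub>G\<^esub> k))"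
      using S that unfolding quasicrossed_systems_def by blast
    then show ?thesis
      using that by (simp add: eq eqs ac tc pc B'.mult_closed)
  qed
  moreover have "qtwist S g \<one>\<^bsub>G\<^esub> = \<one>\<^bsub>B'\<^esub> \<and> qtwist S \<one>\<^bsub>G\<^esub> g = \<one>\<^bsub>B'\<^esub>" if "g \<in> carrier G" for g
    using S that carr by (simp add: quasicrossed_systems_def)
  ultimately show ?thesis
    unfolding quasicrossed_systems_def
    using G.group_axioms B' coc aut tu by simp
qed

text \<open>The witness \<open>u\<close> is kept. Agreement of \<open>T\<close> with
  \<open>R\<close> is asked for on the carriers only, because outside A_e the systems of two choices
  of units in different algebras are unrelated.\<close>

lemma system_equiv_cong:
  assumes same: "same_algebra K B B'"
    and T: "T \<in> quasicrossed_systems K G B'"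
    and coc: "\<And>g h k. g \<in> carrier G \<Longrightarrow> h \<in> carrier G \<Longrightarrow> k \<in> carrier G \<Longrightarrow> qcoc T g h k = qcoc R g h k"
    and act: "\<And>g x. g \<in> carrier G \<Longrightarrow> x \<in> carrier B \<Longrightarrow> qact T g x = qact R g x"
    and tw: "\<And>g h. g \<in> carrier G \<Longrightarrow> h \<in> carrier G \<Longrightarrow> qtwist T g h = qtwist R g h"
    and RS: "(R, S) \<in> system_equiv K G B"
  shows "(T, S) \<in> system_equiv K G B'"
proof -
  have B': "assoc_unital_algebra K B'" and G: "group G"
    using T by (simp_all add: quasicrossed_systems_def)
  interpret B': assoc_unital_algebra K B' by (rule B')
  interpret G: group G by (rule G)
  from RS obtain u where u: "u \<in> carrier G \<rightarrow> lr_units B" "u \<one>\<^bsub>G\<^esub> = \<one>\<^bsub>B\<^esub>"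
    and S: "S \<in> quasicrossed_systems K G B"
    and cocS: "\<And>g h k. g \<in> carrier G \<Longrightarrow> h \<in> carrier G \<Longrightarrow> k \<in> carrier G \<Longrightarrow> qcoc S g h k = qcoc R g h k"
    and actS: "\<And>g x. g \<in> carrier G \<Longrightarrow> x \<in> carrier B \<Longrightarrow>
      qact S g x = u g \<otimes>\<^bsub>B\<^esub> qact R g x \<otimes>\<^bsub>B\<^esub> inv\<^bsub>B\<^esub> (u g)"
    and twS: "\<And>g h. g \<in> carrier G \<Longrightarrow> h \<in> carrier G \<Longrightarrow>
      qtwist S g h = u g \<otimes>\<^bsub>B\<^esub> qact R g (u h) \<otimes>\<^bsub>B\<^esub> qtwist R g h \<otimes>\<^bsub>B\<^esub> inv\<^bsub>B\<^esub> (u (g \<otimes>\<^bsub>G\<^esub> h))"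
    unfolding system_equiv_def by blast
  have eq: "x \<otimes>\<^bsub>B\<^esub> y = x \<otimes>\<^bsub>B'\<^esub> y" if "x \<in> carrier B'" "y \<in> carrier B'" for x y
    using same that by (simp add: same_algebra_def)
  have carr: "carrier B = carrier B'" "\<one>\<^bsub>B\<^esub> = \<one>\<^bsub>B'\<^esub>"
    using same by (simp_all add: same_algebra_def)
  have u': "u \<in> carrier G \<rightarrow> lr_units B'"
    using u(1) same_algebra_lr_units[OF same] by simp
  have uc: "u g \<in> carrier B'" if "g \<in> carrier G" for g
    using u' that by (auto simp: lr_units_def)
  have ui: "inv\<^bsub>B\<^esub> (u g) = inv\<^bsub>B'\<^esub> (u g)" "inv\<^bsub>B'\<^esub> (u g) \<in> carrier B'" if "g \<in> carrier G" for g
    using same_algebra_inv[OF same] uc[OF that] carr B'.lr_units_inv(1)[of "u g"] u' that by auto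
  have ac: "qact T g x \<in> carrier B'" if "g \<in> carrier G" "x \<in> carrier B'" for g x
    using T that by (auto simp: quasicrossed_systems_def algebra_iso_def ring_iso_def ring_hom_def)
  have tc: "qtwist T g h \<in> carrier B'" if "g \<in> carrier G" "h \<in> carrier G" for g h
    using T that by (auto simp: quasicrossed_systems_def lr_units_def)
  have "S \<in> quasicrossed_systems K G B'"
    by (rule quasicrossed_systems_same_algebra[OF same B' S])
  moreover have "qact S g x = u g \<otimes>\<^bsub>B'\<^esub> qact T g x \<otimes>\<^bsub>B'\<^esub> inv\<^bsub>B'\<^esub> (u g)"
    if "g \<in> carrier G" "x \<in> carrier B'" for g x
    using actS[of g x] that act[of g x, symmetric] by (simp add: carr eq ac uc ui B'.mult_closed)
  moreover have "qtwist S g h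
      = u g \<otimes>\<^bsub>B'\<^esub> qact T g (u h) \<otimes>\<^bsub>B'\<^esub> qtwist T g h \<otimes>\<^bsub>B'\<^esub> inv\<^bsub>B'\<^esub> (u (g \<otimes>\<^bsub>G\<^esub> h))"
    if "g \<in> carrier G" "h \<in> carrier G" for g h
    using twS[of g h] that act[of g "u h", symmetric] tw[of g h, symmetric]
    by (simp add: carr eq ac uc tc ui B'.mult_closed)
  ultimately show ?thesis
    unfolding system_equiv_def using T u' u(2) carr(2) coc cocS by auto
qed

text \<open>The constant map to 1 is a witness, since automorphisms fix 1. It places the system of a
  choice of units in the class determined by the product.\<close>

lemma system_equiv_refl:
  assumes S: "S \<in> quasicrossed_systems K G B"
  shows "(S, S) \<in> system_equiv K G B"
proof -
  have "assoc_unital_algebra K B" and "group G"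
    using S by (simp_all add: quasicrossed_systems_def)
  then interpret B: assoc_unital_algebra K B + G: group G .
  have one: "\<one>\<^bsub>B\<^esub> \<in> lr_units B"
    using B.unit_closed B.unit_l by (auto simp: lr_units_def)
  have inv: "inv\<^bsub>B\<^esub> \<one>\<^bsub>B\<^esub> = \<one>\<^bsub>B\<^esub>"
    using B.lr_units_inv[OF one] B.unit_l by metis
  have ac: "qact S g x \<in> carrier B" "qact S g \<one>\<^bsub>B\<^esub> = \<one>\<^bsub>B\<^esub>" if "g \<in> carrier G" "x \<in> carrier B" for g x
    using S that by (auto simp: quasicrossed_systems_def algebra_iso_def ring_iso_def ring_hom_def)
  have tc: "qtwist S g h \<in> carrier B" if "g \<in> carrier G" "h \<in> carrier G" for g h
    using S that by (auto simp: quasicrossed_systems_def lr_units_def)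
  have "\<exists>u\<in>carrier G \<rightarrow> lr_units B. u \<one>\<^bsub>G\<^esub> = \<one>\<^bsub>B\<^esub> \<and>
      (\<forall>g\<in>carrier G. \<forall>x\<in>carrier B. qact S g x = u g \<otimes>\<^bsub>B\<^esub> qact S g x \<otimes>\<^bsub>B\<^esub> inv\<^bsub>B\<^esub> (u g)) \<and>
      (\<forall>g\<in>carrier G. \<forall>h\<in>carrier G. qtwist S g h
        = u g \<otimes>\<^bsub>B\<^esub> qact S g (u h) \<otimes>\<^bsub>B\<^esub> qtwist S g h \<otimes>\<^bsub>B\<^esub> inv\<^bsub>B\<^esub> (u (g \<otimes>\<^bsub>G\<^esub> h)))"
    using one ac tc B.unit_l B.unit_r B.unit_closed
    by (intro bexI[of _ "\<lambda>_. \<one>\<^bsub>B\<^esub>"]) (auto simp: inv)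
  then show ?thesis
    using S by (simp add: system_equiv_def)
qed

section \<open>Equivalent products and equivalent systems\<close>

lemma equivalent_productsE:
  assumes "equivalent_products K G A gr A' gr'"
  obtains f where "f \<in> ring_iso A A'"
    and "\<And>a x. a \<in> carrier K \<Longrightarrow> x \<in> carrier A \<Longrightarrow> f (a \<odot>\<^bsub>A\<^esub> x) = a \<odot>\<^bsub>A'\<^esub> f x"
    and "\<And>g. g \<in> carrier G \<Longrightarrow> f ` gr g = gr' g"
    and "\<And>x. x \<in> gr \<one>\<^bsub>G\<^esub> \<Longrightarrow> f x = x"
proof -
  from assms obtain f where "f \<in> algebra_iso K A A'"
    "\<forall>g\<in>carrier G. f ` gr g = gr' g" "\<forall>x\<in>gr \<one>\<^bsub>G\<^esub>. f x = x"
    unfolding equivalent_products_def by (elim bexE conjE)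
  then show thesis
    by (intro that[of f]) (simp_all add: algebra_iso_def)
qed

text \<open>The inverse isomorphism serves. With symmetry available, equality of the determined
  classes needs only one inclusion.\<close>

lemma equivalent_products_sym:
  fixes K :: "('k, 'm) ring_scheme" and G :: "('g, 'n) monoid_scheme"
    and A :: "('k, 'a, 'p) module_scheme" and A' :: "('k, 'a, 'q) module_scheme"
  assumes A: "graded_algebra K G A gr" and A': "graded_algebra K G A' gr'"
    and eq: "equivalent_products K G A gr A' gr'"
  shows "equivalent_products K G A' gr' A gr"
proof -
  interpret A: graded_algebra K G A gr by (rule A)
  interpret A': graded_algebra K G A' gr' by (rule A')
  obtain f where f: "f \<in> ring_iso A A'"
    and fs: "\<And>a x. a \<in> carrier K \<Longrightarrow> x \<in> carrier A \<Longrightarrow> f (a \<odot>\<^bsub>A\<^esub> x) = a \<odot>\<^bsub>A'\<^esub> f x"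
    and gr: "\<And>g. g \<in> carrier G \<Longrightarrow> f ` gr g = gr' g"
    and neutral: "\<And>x. x \<in> gr \<one>\<^bsub>G\<^esub> \<Longrightarrow> f x = x"
    by (rule equivalent_productsE[OF eq]) (rule that, assumption+)
  have bij: "bij_betw f (carrier A) (carrier A')" and hom: "f \<in> ring_hom A A'"
    using f by (simp_all add: ring_iso_def)
  note hom' = ring_hom_memE[OF hom]
  define f' where "f' = inv_into (carrier A) f"
  have bij': "bij_betw f' (carrier A') (carrier A)"
    unfolding f'_def by (rule bij_betw_inv_into[OF bij])
  have f'f: "f' (f x) = x" if "x \<in> carrier A" for x
    unfolding f'_def using bij that by (rule bij_betw_inv_into_left)
  have ff': "f (f' x) = x" if "x \<in> carrier A'" for x
    unfolding f'_def using bij that by (rule bij_betw_inv_into_right)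
  have f'c: "f' x \<in> carrier A" if "x \<in> carrier A'" for x
    using bij' that by (rule bij_betw_apply)
  have "f' \<in> ring_hom A' A"
  proof (rule ring_hom_memI)
    show "f' (x \<otimes>\<^bsub>A'\<^esub> y) = f' x \<otimes>\<^bsub>A\<^esub> f' y" if "x \<in> carrier A'" "y \<in> carrier A'" for x y
      using f'f[of "f' x \<otimes>\<^bsub>A\<^esub> f' y"] that by (simp add: hom' ff' f'c A.mult_closed)
    show "f' (x \<oplus>\<^bsub>A'\<^esub> y) = f' x \<oplus>\<^bsub>A\<^esub> f' y" if "x \<in> carrier A'" "y \<in> carrier A'" for x y
      using f'f[of "f' x \<oplus>\<^bsub>A\<^esub> f' y"] that by (simp add: hom' ff' f'c)
    show "f' \<one>\<^bsub>A'\<^esub> = \<one>\<^bsub>A\<^esub>"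
      using f'f[OF A.unit_closed] by (simp add: hom')
  qed (rule f'c)
  moreover have "f' (a \<odot>\<^bsub>A'\<^esub> x) = a \<odot>\<^bsub>A\<^esub> f' x" if "a \<in> carrier K" "x \<in> carrier A'" for a x
    using f'f[of "a \<odot>\<^bsub>A\<^esub> f' x"] that by (simp add: fs ff' f'c)
  ultimately have "f' \<in> algebra_iso K A' A"
    using bij' by (simp add: algebra_iso_def ring_iso_def)
  moreover have "f' ` gr' g = gr g" if g: "g \<in> carrier G" for g
  proof -
    have "f' ` gr' g = (\<lambda>x. f' (f x)) ` gr g"
      by (simp add: image_image flip: gr[OF g])
    also have "\<dots> = gr g"
      using f'f A.gr_carrier[OF g] by simp
    finally show ?thesis .
  qed
  moreover have "f' x = x" if "x \<in> gr' \<one>\<^bsub>G\<^esub>" for x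
  proof -
    have "gr' \<one>\<^bsub>G\<^esub> = gr \<one>\<^bsub>G\<^esub>" using gr[of "\<one>\<^bsub>G\<^esub>"] neutral by simp
    then have "x \<in> gr \<one>\<^bsub>G\<^esub>" using that by simp
    then show ?thesis using f'f[of x] neutral A.gr_carrier[OF A.G.one_closed] by simp
  qed
  ultimately show ?thesis
    unfolding equivalent_products_def by blast
qed

lemma determined_class_subset:
  fixes K :: "('k, 'm) ring_scheme" and G :: "('g, 'n) monoid_scheme"
    and A :: "('k, 'a, 'p) module_scheme" and A' :: "('k, 'a, 'q) module_scheme"
  assumes A: "graded_quasialgebra K G A gr \<phi>" and A': "graded_quasialgebra K G A' gr' \<phi>'"
    and same: "same_algebra K (neutral_algebra G A gr) (neutral_algebra G A' gr')"
    and eq: "equivalent_products K G A gr A' gr'"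
  shows "determined_class K G A gr \<phi> \<subseteq> determined_class K G A' gr' \<phi>'"
proof
  interpret A: graded_quasialgebra K G A gr \<phi> by (rule A)
  interpret A': graded_quasialgebra K G A' gr' \<phi>' by (rule A')
  obtain f where f: "f \<in> ring_iso A A'"
    and fs: "\<And>a x. a \<in> carrier K \<Longrightarrow> x \<in> carrier A \<Longrightarrow> f (a \<odot>\<^bsub>A\<^esub> x) = a \<odot>\<^bsub>A'\<^esub> f x"
    and gr: "\<And>g. g \<in> carrier G \<Longrightarrow> f ` gr g = gr' g"
    and neutral: "\<And>x. x \<in> gr \<one>\<^bsub>G\<^esub> \<Longrightarrow> f x = x"
    by (rule equivalent_productsE[OF eq]) (rule that, assumption+)
  have "f \<in> ring_hom A A'" using f by (simp add: ring_iso_def)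
  note hom = ring_hom_memE[OF this]
  have gre: "gr' \<one>\<^bsub>G\<^esub> = gr \<one>\<^bsub>G\<^esub>" using gr[of "\<one>\<^bsub>G\<^esub>"] neutral by simp
  fix S assume "S \<in> determined_class K G A gr \<phi>"
  then obtain c where c: "c \<in> unit_choices G A gr"
    and S: "(system_of_choice G A \<phi> c, S) \<in> system_equiv K G A.N"
    unfolding determined_class_def by blast
  have cA: "c g \<in> carrier A" if "g \<in> carrier G" for g
    using A.choice_gr[OF c that] A.gr_carrier that by blast
  \<comment> \<open>A homomorphism preserving 1 sends left and right inverses to left and right
    inverses.\<close>
  have fu: "f x \<in> lr_units A'" if "x \<in> lr_units A" for x
    using that hom unfolding lr_units_def by (smt (verit) mem_Collect_eq)
  define d where "d = (\<lambda>g. f (c g))"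
  have dg: "d g \<in> lr_units A' \<inter> gr' g" if g: "g \<in> carrier G" for g
    using fu A.choice_hunits[OF c g] gr[OF g] by (auto simp: d_def)
  have d: "d \<in> unit_choices G A' gr'"
    using dg A.choice_one[OF c] hom(4) by (simp add: unit_choices_def d_def)
  \<comment> \<open>Equivalence of systems includes equality of the cocycles, so this has to be
    extracted from \<open>f\<close>: applying \<open>f\<close> to the rebracketing of c(g), c(h),
    c(k) gives two scalars acting alike on \<open>?z\<close>, which is nonzero as a product of
    units.\<close>
  have coc: "\<phi>' g h k = \<phi> g h k" if g: "g \<in> carrier G" and h: "h \<in> carrier G" and k: "k \<in> carrier G" for g h k
  proof -
    let ?z = "d g \<otimes>\<^bsub>A'\<^esub> (d h \<otimes>\<^bsub>A'\<^esub> d k)"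
    have z: "?z \<in> lr_units A' \<inter> gr' (g \<otimes>\<^bsub>G\<^esub> (h \<otimes>\<^bsub>G\<^esub> k))"
      using g h k dg by (intro A'.hunits_mult) auto
    have zc: "?z \<in> carrier A'" using z by (simp add: lr_units_def)
    have "\<phi>' g h k \<odot>\<^bsub>A'\<^esub> ?z = (d g \<otimes>\<^bsub>A'\<^esub> d h) \<otimes>\<^bsub>A'\<^esub> d k"
      using A'.quasi_assoc[OF g h k] dg g h k by auto
    also have "\<dots> = f ((c g \<otimes>\<^bsub>A\<^esub> c h) \<otimes>\<^bsub>A\<^esub> c k)"
      using g h k by (simp add: d_def hom cA A.mult_closed)
    also have "\<dots> = f (\<phi> g h k \<odot>\<^bsub>A\<^esub> (c g \<otimes>\<^bsub>A\<^esub> (c h \<otimes>\<^bsub>A\<^esub> c k)))"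
      using A.quasi_assoc[OF g h k] A.choice_gr[OF c] g h k by simp
    also have "\<dots> = \<phi> g h k \<odot>\<^bsub>A'\<^esub> ?z"
      using g h k by (simp add: d_def hom cA A.mult_closed fs A.phi_closed)
    finally show ?thesis
      using A'.smult_scalar_cancel[OF A'.phi_closed A.phi_closed zc A'.hunit_neq_zero[OF z]] g h k
      by blast
  qed
  have act: "A'.act d g x = A.act c g x" if g: "g \<in> carrier G" and x: "x \<in> gr \<one>\<^bsub>G\<^esub>" for g x
  proof (rule A'.act_eqI[OF d g])
    note a = A.act_gr[OF c g x]
    show "A.act c g x \<in> gr' \<one>\<^bsub>G\<^esub>" using a gre by simp
    \<comment> \<open>Both \<open>x\<close> and \<open>A.act c g x\<close> lie in A_e and are fixed
      by \<open>f\<close>, whereas \<open>c g\<close> goes to \<open>d g\<close>; the defining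
      relation in \<open>A\<close> becomes the one in \<open>A'\<close>.\<close>
    have "f (A.act c g x \<otimes>\<^bsub>A\<^esub> c g) = f (c g \<otimes>\<^bsub>A\<^esub> x)"
      using A.act_mult[OF c g x] by simp
    then show "A.act c g x \<otimes>\<^bsub>A'\<^esub> d g = d g \<otimes>\<^bsub>A'\<^esub> x"
      using g a x A.gr_carrier[OF A.G.one_closed] by (simp add: hom cA neutral d_def)
  qed
  have tw: "A'.tw d g h = A.tw c g h" if g: "g \<in> carrier G" and h: "h \<in> carrier G" for g h
  proof (rule A'.twist_eqI[OF d g h])
    note t = A.twist_gr[OF c g h]
    show "A.tw c g h \<in> gr' \<one>\<^bsub>G\<^esub>" using t gre by simp
    have "f (A.tw c g h \<otimes>\<^bsub>A\<^esub> c (g \<otimes>\<^bsub>G\<^esub> h)) = f (c g \<otimes>\<^bsub>A\<^esub> c h)"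
      using A.twist_mult[OF c g h] by simp
    then show "A.tw c g h \<otimes>\<^bsub>A'\<^esub> d (g \<otimes>\<^bsub>G\<^esub> h) = d g \<otimes>\<^bsub>A'\<^esub> d h"
      using g h t A.gr_carrier[OF A.G.one_closed] by (simp add: hom cA neutral d_def)
  qed
  have "(system_of_choice G A' \<phi>' d, S) \<in> system_equiv K G A'.N"
  proof (rule system_equiv_cong[OF same A'.system_of_choice_mem[OF d] _ _ _ S])
    show "qcoc (system_of_choice G A' \<phi>' d) g h k = qcoc (system_of_choice G A \<phi> c) g h k"
      if "g \<in> carrier G" "h \<in> carrier G" "k \<in> carrier G" for g h k
      using coc[OF that] by (simp add: system_of_choice_def)
  qed (use act tw in simp_all)
  then show "S \<in> determined_class K G A' gr' \<phi>'"
    unfolding determined_class_def using d by blast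
qed

lemma equivalent_productsI:
  fixes K :: "('k, 'm) ring_scheme" and G :: "('g, 'n) monoid_scheme"
    and A :: "('k, 'a, 'p) module_scheme" and A' :: "('k, 'a, 'q) module_scheme"
  assumes A: "graded_quasialgebra K G A gr \<phi>" and A': "graded_quasialgebra K G A' gr' \<phi>'"
    and same: "same_algebra K (neutral_algebra G A gr) (neutral_algebra G A' gr')"
    and c: "c \<in> unit_choices G A gr" and d: "d \<in> unit_choices G A' gr'"
    and act: "\<And>g x. g \<in> carrier G \<Longrightarrow> x \<in> gr \<one>\<^bsub>G\<^esub> \<Longrightarrow>
      qact (system_of_choice G A' \<phi>' d) g x = qact (system_of_choice G A \<phi> c) g x"
    and tw: "\<And>g h. g \<in> carrier G \<Longrightarrow> h \<in> carrier G \<Longrightarrow>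
      qtwist (system_of_choice G A' \<phi>' d) g h = qtwist (system_of_choice G A \<phi> c) g h"
  shows "equivalent_products K G A gr A' gr'"
proof -
  interpret A: graded_quasialgebra K G A gr \<phi> by (rule A)
  interpret A': graded_quasialgebra K G A' gr' \<phi>' by (rule A')
  note e = A.G.one_closed
  have gre: "gr' \<one>\<^bsub>G\<^esub> = gr \<one>\<^bsub>G\<^esub>" and ones: "\<one>\<^bsub>A'\<^esub> = \<one>\<^bsub>A\<^esub>"
    and ops: "\<And>x y. x \<in> gr \<one>\<^bsub>G\<^esub> \<Longrightarrow> y \<in> gr \<one>\<^bsub>G\<^esub> \<Longrightarrow> x \<oplus>\<^bsub>A'\<^esub> y = x \<oplus>\<^bsub>A\<^esub> y"
      "\<And>x y. x \<in> gr \<one>\<^bsub>G\<^esub> \<Longrightarrow> y \<in> gr \<one>\<^bsub>G\<^esub> \<Longrightarrow> x \<otimes>\<^bsub>A'\<^esub> y = x \<otimes>\<^bsub>A\<^esub> y"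
      "\<And>a x. a \<in> carrier K \<Longrightarrow> x \<in> gr \<one>\<^bsub>G\<^esub> \<Longrightarrow> a \<odot>\<^bsub>A'\<^esub> x = a \<odot>\<^bsub>A\<^esub> x"
    using same by (simp_all add: same_algebra_def)
  \<comment> \<open>\<open>D g y\<close> is the coefficient in A_e of \<open>y\<close> with respect
    to \<open>c g\<close>, and \<open>D' g z\<close> that of \<open>z\<close> with respect to
    \<open>d g\<close>. In each degree the isomorphism keeps the coefficient and exchanges the
    unit.\<close>
  define D where "D g y = y \<otimes>\<^bsub>A\<^esub> right_inv A (c g)" for g y
  define D' where "D' g z = z \<otimes>\<^bsub>A'\<^esub> right_inv A' (d g)" for g z
  have D: "D g y \<in> gr \<one>\<^bsub>G\<^esub>" "D g y \<otimes>\<^bsub>A\<^esub> c g = y" if g: "g \<in> carrier G" and y: "y \<in> gr g" for g y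
    using A.hunit_div[OF g A.choice_hunits[OF c g] y] by (simp_all add: D_def)
  have D': "D' g z \<in> gr \<one>\<^bsub>G\<^esub>" "D' g z \<otimes>\<^bsub>A'\<^esub> d g = z" if g: "g \<in> carrier G" and z: "z \<in> gr' g" for g z
    using A'.hunit_div[OF g A'.choice_hunits[OF d g] z] gre by (simp_all add: D'_def)
  have Deq: "D g (b \<otimes>\<^bsub>A\<^esub> c g) = b" if "g \<in> carrier G" "b \<in> gr \<one>\<^bsub>G\<^esub>" for g b
    using A.hunit_mult_div[OF _ A.choice_hunits[OF c]] that by (simp add: D_def)
  have D'eq: "D' g (b \<otimes>\<^bsub>A'\<^esub> d g) = b" if "g \<in> carrier G" "b \<in> gr \<one>\<^bsub>G\<^esub>" for g b
    using A'.hunit_mult_div[OF _ A'.choice_hunits[OF d]] that gre by (simp add: D'_def)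
  note cg = A.choice_gr[OF c] and dg = A'.choice_gr[OF d]
  have eA: "x \<in> carrier A" "x \<in> carrier A'" if "x \<in> gr \<one>\<^bsub>G\<^esub>" for x
    using that A.gr_carrier[OF e] A'.gr_carrier[OF e] gre by auto
  have cA: "c g \<in> carrier A" and dA: "d g \<in> carrier A'" if "g \<in> carrier G" for g
    using A.gr_carrier[OF that cg[OF that]] A'.gr_carrier[OF that dg[OF that]] by auto
  have cgr: "b \<otimes>\<^bsub>A\<^esub> c g \<in> gr g" and dgr: "b \<otimes>\<^bsub>A'\<^esub> d g \<in> gr' g"
    if "g \<in> carrier G" "b \<in> gr \<one>\<^bsub>G\<^esub>" for g b
    using A.gr_mult_one_l[OF that(1) that(2) cg] A'.gr_mult_one_l[OF that(1) _ dg] that gre by auto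
  obtain f where f: "f \<in> algebra_iso K A A'"
    and fF: "\<And>g x. g \<in> carrier G \<Longrightarrow> x \<in> gr g \<Longrightarrow> f x = D g x \<otimes>\<^bsub>A'\<^esub> d g"
  proof (rule graded_iso_extension[where F = "\<lambda>g y. D g y \<otimes>\<^bsub>A'\<^esub> d g" and F' = "\<lambda>g z. D' g z \<otimes>\<^bsub>A\<^esub> c g"])
    show "graded_algebra K G A gr" "graded_algebra K G A' gr'" by unfold_locales
    show "D g y \<otimes>\<^bsub>A'\<^esub> d g \<in> gr' g" if "g \<in> carrier G" "y \<in> gr g" for g y
      using dgr D that by simp
    show "D' g z \<otimes>\<^bsub>A\<^esub> c g \<in> gr g" if "g \<in> carrier G" "z \<in> gr' g" for g z
      using cgr D' that by simp
    show "D' g (D g y \<otimes>\<^bsub>A'\<^esub> d g) \<otimes>\<^bsub>A\<^esub> c g = y" if "g \<in> carrier G" "y \<in> gr g" for g y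
      using D D'eq that by simp
    show "D g (D' g z \<otimes>\<^bsub>A\<^esub> c g) \<otimes>\<^bsub>A'\<^esub> d g = z" if "g \<in> carrier G" "z \<in> gr' g" for g z
      using D' Deq that by simp
    show "D g (x \<oplus>\<^bsub>A\<^esub> y) \<otimes>\<^bsub>A'\<^esub> d g = (D g x \<otimes>\<^bsub>A'\<^esub> d g) \<oplus>\<^bsub>A'\<^esub> (D g y \<otimes>\<^bsub>A'\<^esub> d g)"
      if g: "g \<in> carrier G" and x: "x \<in> gr g" and y: "y \<in> gr g" for g x y
    proof -
      note xy = D(1)[OF g x] D(1)[OF g y]
      have "x \<oplus>\<^bsub>A\<^esub> y = (D g x \<oplus>\<^bsub>A\<^esub> D g y) \<otimes>\<^bsub>A\<^esub> c g"
        using A.mult_l_distr[OF eA(1)[OF xy(1)] eA(1)[OF xy(2)] cA[OF g]] D(2) g x y by simp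
      then have "D g (x \<oplus>\<^bsub>A\<^esub> y) = D g x \<oplus>\<^bsub>A'\<^esub> D g y"
        using Deq[OF g A.gr_add[OF e xy]] ops(1)[OF xy] by simp
      then show ?thesis
        using A'.mult_l_distr[OF eA(2)[OF xy(1)] eA(2)[OF xy(2)] dA[OF g]] by simp
    qed
    show "D g (a \<odot>\<^bsub>A\<^esub> x) \<otimes>\<^bsub>A'\<^esub> d g = a \<odot>\<^bsub>A'\<^esub> (D g x \<otimes>\<^bsub>A'\<^esub> d g)"
      if g: "g \<in> carrier G" and a: "a \<in> carrier K" and x: "x \<in> gr g" for g a x
    proof -
      note x' = D(1)[OF g x]
      have "a \<odot>\<^bsub>A\<^esub> x = (a \<odot>\<^bsub>A\<^esub> D g x) \<otimes>\<^bsub>A\<^esub> c g"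
        using A.smult_mult_l[OF a eA(1)[OF x'] cA[OF g]] D(2)[OF g x] by simp
      then have "D g (a \<odot>\<^bsub>A\<^esub> x) = a \<odot>\<^bsub>A'\<^esub> D g x"
        using Deq[OF g A.gr_smult[OF e a x']] ops(3)[OF a x'] by simp
      then show ?thesis
        using A'.smult_mult_l[OF a eA(2)[OF x'] dA[OF g]] by simp
    qed
    show "D (g \<otimes>\<^bsub>G\<^esub> h) (x \<otimes>\<^bsub>A\<^esub> y) \<otimes>\<^bsub>A'\<^esub> d (g \<otimes>\<^bsub>G\<^esub> h) = (D g x \<otimes>\<^bsub>A'\<^esub> d g) \<otimes>\<^bsub>A'\<^esub> (D h y \<otimes>\<^bsub>A'\<^esub> d h)"
      if g: "g \<in> carrier G" and h: "h \<in> carrier G" and x: "x \<in> gr g" and y: "y \<in> gr h" for g h x y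
    proof -
      have gh: "g \<otimes>\<^bsub>G\<^esub> h \<in> carrier G" using g h by simp
      note b = D(1)[OF g x] D(1)[OF h y]
      note b' = b[folded gre]
      let ?s = "A.act c g (D h y)" and ?t = "A.tw c g h"
      have s: "?s \<in> gr \<one>\<^bsub>G\<^esub>" and t: "?t \<in> gr \<one>\<^bsub>G\<^esub>"
        using A.act_gr[OF c g b(2)] A.twist_gr[OF c g h] .
      have bs: "D g x \<otimes>\<^bsub>A\<^esub> ?s \<in> gr \<one>\<^bsub>G\<^esub>" by (rule A.gr_mult_one_l[OF e b(1) s])
      have "x \<otimes>\<^bsub>A\<^esub> y = (D g x \<otimes>\<^bsub>A\<^esub> c g) \<otimes>\<^bsub>A\<^esub> (D h y \<otimes>\<^bsub>A\<^esub> c h)"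
        using D(2)[OF g x] D(2)[OF h y] by simp
      also have "\<dots> = ((D g x \<otimes>\<^bsub>A\<^esub> ?s) \<otimes>\<^bsub>A\<^esub> ?t) \<otimes>\<^bsub>A\<^esub> c (g \<otimes>\<^bsub>G\<^esub> h)"
        by (rule A.hunit_product[OF g h cg[OF g] cg[OF h] cg[OF gh] b s t
              A.act_mult[OF c g b(2)] A.twist_mult[OF c g h]])
      finally have "D (g \<otimes>\<^bsub>G\<^esub> h) (x \<otimes>\<^bsub>A\<^esub> y) = (D g x \<otimes>\<^bsub>A\<^esub> ?s) \<otimes>\<^bsub>A\<^esub> ?t"
        using Deq[OF gh A.gr_mult_one_l[OF e bs t]] by simp
      also have "\<dots> = (D g x \<otimes>\<^bsub>A'\<^esub> ?s) \<otimes>\<^bsub>A'\<^esub> ?t"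
        using ops(2) b(1) s t bs by simp
      finally have "D (g \<otimes>\<^bsub>G\<^esub> h) (x \<otimes>\<^bsub>A\<^esub> y) = (D g x \<otimes>\<^bsub>A'\<^esub> ?s) \<otimes>\<^bsub>A'\<^esub> ?t" .
      \<comment> \<open>The same product formula in \<open>A'\<close>. By \<open>act\<close> and
        \<open>tw\<close> its coefficient is built from the same \<sigma> and \<alpha>, and on A_e
        the two multiplications coincide.\<close>
      moreover have "(D g x \<otimes>\<^bsub>A'\<^esub> d g) \<otimes>\<^bsub>A'\<^esub> (D h y \<otimes>\<^bsub>A'\<^esub> d h)
          = ((D g x \<otimes>\<^bsub>A'\<^esub> ?s) \<otimes>\<^bsub>A'\<^esub> ?t) \<otimes>\<^bsub>A'\<^esub> d (g \<otimes>\<^bsub>G\<^esub> h)"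
        by (rule A'.hunit_product[OF g h dg[OF g] dg[OF h] dg[OF gh] b' s[folded gre] t[folded gre]
              A'.act_mult[OF d g b'(2), unfolded act[OF g b(2)]]
              A'.twist_mult[OF d g h, unfolded tw[OF g h]]])
      ultimately show ?thesis by simp
    qed
    show "D \<one>\<^bsub>G\<^esub> \<one>\<^bsub>A\<^esub> \<otimes>\<^bsub>A'\<^esub> d \<one>\<^bsub>G\<^esub> = \<one>\<^bsub>A'\<^esub>"
      using Deq[OF e A.one_gr] A.unit_l[OF A.unit_closed] A'.unit_l[OF A'.unit_closed]
        A.choice_one[OF c] A'.choice_one[OF d] ones by simp
  qed (rule that, assumption+)
  have "f ` gr g = gr' g" if g: "g \<in> carrier G" for g
  proof
    show "f ` gr g \<subseteq> gr' g"
      using fF[OF g] dgr[OF g D(1)[OF g]] by auto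
    show "gr' g \<subseteq> f ` gr g"
    proof
      fix z assume z: "z \<in> gr' g"
      have "f (D' g z \<otimes>\<^bsub>A\<^esub> c g) = z"
        using fF[OF g cgr[OF g D'(1)[OF g z]]] Deq[OF g D'(1)[OF g z]] D'(2)[OF g z] by simp
      then show "z \<in> f ` gr g"
        using cgr[OF g D'(1)[OF g z]] by force
    qed
  qed
  \<comment> \<open>In degree e both units are 1, so an element is its own coefficient.\<close>
  moreover have "f x = x" if x: "x \<in> gr \<one>\<^bsub>G\<^esub>" for x
    using fF[OF e x] Deq[OF e x] A.unit_r[OF eA(1)[OF x]] A'.unit_r[OF eA(2)[OF x]]
      A.choice_one[OF c] A'.choice_one[OF d] by simp
  ultimately show ?thesis
    unfolding equivalent_products_def using f by blast
qed

theorem theorem5p4: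
  fixes K :: "('k, 'm) ring_scheme"
    and G :: "('g, 'n) monoid_scheme"
    and A :: "('k, 'a, 'p) module_scheme" and gr :: "'g \<Rightarrow> 'a set"
    and A' :: "('k, 'a, 'q) module_scheme" and gr' :: "'g \<Rightarrow> 'a set"
    and \<phi> \<phi>' :: "'g \<Rightarrow> 'g \<Rightarrow> 'g \<Rightarrow> 'k"
  assumes "algebraically_closed K" and "char_zero K" and "group G"
    and "quasicrossed_product K G A gr \<phi>"
    and "quasicrossed_product K G A' gr' \<phi>'"
    and "same_algebra K (neutral_algebra G A gr) (neutral_algebra G A' gr')"
  shows "equivalent_products K G A gr A' gr' \<longleftrightarrow>
    determined_class K G A gr \<phi> = determined_class K G A' gr' \<phi>'"
proof
  interpret A: quasicrossed_product K G A gr \<phi> by fact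
  interpret A': quasicrossed_product K G A' gr' \<phi>' by fact
  note same = \<open>same_algebra K A.N A'.N\<close>
  note Aq = A.graded_quasialgebra_axioms and A'q = A'.graded_quasialgebra_axioms
  {
    assume eq: "equivalent_products K G A gr A' gr'"
    have "equivalent_products K G A' gr' A gr"
      by (rule equivalent_products_sym[OF A.graded_algebra_axioms A'.graded_algebra_axioms eq])
    then show "determined_class K G A gr \<phi> = determined_class K G A' gr' \<phi>'"
      using determined_class_subset[OF Aq A'q same eq]
        determined_class_subset[OF A'q Aq same_algebra_sym[OF same]] by blast
  next
    assume eq: "determined_class K G A gr \<phi> = determined_class K G A' gr' \<phi>'"
    obtain c where c: "c \<in> unit_choices G A gr"
      using A.unit_choices_nonempty by blast
    let ?S = "system_of_choice G A \<phi> c"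
    \<comment> \<open>As a member of its own class, \<open>?S\<close> also lies in the class of
      \<open>A'\<close>, and unfolding that class produces units \<open>c'\<close> of
      \<open>A'\<close> together with the witness \<open>u\<close>.\<close>
    have "?S \<in> determined_class K G A gr \<phi>"
      unfolding determined_class_def
      using c system_equiv_refl[OF A.system_of_choice_mem[OF c]] by blast
    then obtain c' where c': "c' \<in> unit_choices G A' gr'"
      and eqv: "(system_of_choice G A' \<phi>' c', ?S) \<in> system_equiv K G A'.N"
      unfolding eq unfolding determined_class_def by blast
    from eqv obtain u where u: "u \<in> carrier G \<rightarrow> lr_units A'.N" and u1: "u \<one>\<^bsub>G\<^esub> = \<one>\<^bsub>A'.N\<^esub>"
      and act: "\<And>g x. g \<in> carrier G \<Longrightarrow> x \<in> carrier A'.N \<Longrightarrow>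
        A.act c g x = u g \<otimes>\<^bsub>A'.N\<^esub> A'.act c' g x \<otimes>\<^bsub>A'.N\<^esub> inv\<^bsub>A'.N\<^esub> (u g)"
      and tw: "\<And>g h. g \<in> carrier G \<Longrightarrow> h \<in> carrier G \<Longrightarrow>
        A.tw c g h = u g \<otimes>\<^bsub>A'.N\<^esub> A'.act c' g (u h) \<otimes>\<^bsub>A'.N\<^esub> A'.tw c' g h
          \<otimes>\<^bsub>A'.N\<^esub> inv\<^bsub>A'.N\<^esub> (u (g \<otimes>\<^bsub>G\<^esub> h))"
      unfolding system_equiv_def by blast
    have gre: "gr' \<one>\<^bsub>G\<^esub> = gr \<one>\<^bsub>G\<^esub>"
      using same by (simp add: same_algebra_def)
    have u1': "u \<one>\<^bsub>G\<^esub> = \<one>\<^bsub>A'\<^esub>"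
      using u1 by simp
    \<comment> \<open>The units \<open>u g\<close> times \<open>c' g\<close> of \<open>A'\<close>
      have, on A_e, the same \<sigma> and \<alpha> as \<open>c\<close>, since the right sides of
      these formulas are those of \<open>act\<close> and \<open>tw\<close>.\<close>
    note r = A'.rescaled_choice[OF c' u u1'] A'.rescaled_act[OF c' u u1'] A'.rescaled_tw[OF c' u u1']
    show "equivalent_products K G A gr A' gr'"
      by (rule equivalent_productsI[OF Aq A'q same c r(1)]) (use act tw r(2,3) gre in simp_all)
  }
qed

end
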